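(* Let $\mu$ be the symmetric exponential measure on the plane $\mathbb{R}^2$, i.e. the measure with density $\frac14 e^{-|x|-|y|}$, and let boundary measures $\mu^+$ be taken with respect to the $\ell_1$-metric. Then among all $1$-unconditional Borel sets of a given measure, an $\ell_1$-ball centred at the origin or the complement of such a ball has the smallest boundary measure. That is, for every $1$-unconditional Borel set $A\subset\mathbb{R}^2$, if $t,s\in[0,\infty]$ are such that $\mu(tB_1^2)=\mu(A)=\mu(\mathbb{R}^2\setminus sB_1^2)$, then $$\mu^+(A)\ge \min\{\mu^+(tB_1^2),\ \mu^+(\mathbb{R}^2\setminus sB_1^2)\}.$$
   Context: For a Borel set $A\subset\mathbb{R}^2$, $A^h=\{x\in\mathbb{R}^2:\ \exists y\in A,\ \|x-y\|_1<h\}$ and $\mu^+(A)=\liminf_{h\to0+}\frac{\mu(A^h)-\mu(A)}{h}$. $B_1^2$ is the unit ball of the $\ell_1$-norm in $\mathbb{R}^2$ centred at the origin; conventions: $0B_1^2=\emptyset$ and $\infty B_1^2=\mathbb{R}^2$. A Borel set $A\subset\mathbb{R}^2$ is called $1$-unconditional if $(x_1,x_2)\in A$ implies $(\varepsilon_1x_1,\varepsilon_2x_2)\in A$ for every choice of signs $\varepsilon_1,\varepsilon_2\in\{-1,1\}$. *)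

theory Defs
  imports "HOL-Analysis.Analysis"
begin

definition sym_exp_measure :: "(real \<times> real) measure" where
  "sym_exp_measure =
     density lborel (\<lambda>(x, y). ennreal (1 / 4 * exp (- \<bar>x\<bar> - \<bar>y\<bar>)))"

text \<open>The library norm on \<^typ>\<open>real \<times> real\<close> is Euclidean, so the \<open>\<ell>\<^sub>1\<close>-norm is
  introduced separately.\<close>

definition l1_norm :: "real \<times> real \<Rightarrow> real" where
  "l1_norm x = \<bar>fst x\<bar> + \<bar>snd x\<bar>"

definition enlargement :: "(real \<times> real) set \<Rightarrow> real \<Rightarrow> (real \<times> real) set" where
  "enlargement A h = {x. \<exists>y\<in>A. l1_norm (x - y) < h}"

text \<open>The lower limit may be infinite, hence the extended-real value. The definition uses
  the real-valued \<^const>\<open>measure\<close> and so is meant for finite \<open>M\<close>.\<close>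

definition boundary_measure ::
  "(real \<times> real) measure \<Rightarrow> (real \<times> real) set \<Rightarrow> ereal" where
  "boundary_measure M A =
     Liminf (at_right 0) (\<lambda>h. ereal ((measure M (enlargement A h) - measure M A) / h))"

definition l1_unit_ball :: "(real \<times> real) set" where
  "l1_unit_ball = {x. l1_norm x \<le> 1}"

text \<open>Dilates of the unit ball by a factor in \<open>[0, \<infinity>]\<close>, with the conventions that the factor
  \<open>0\<close> gives the empty set and the factor \<open>\<infinity>\<close> the whole plane.\<close>

definition l1_ball :: "ennreal \<Rightarrow> (real \<times> real) set" where
  "l1_ball t =
     (if t = 0 then {}
      else if t = \<infinity> then UNIV
      else (\<lambda>x. enn2real t *\<^sub>R x) ` l1_unit_ball)"

definition unconditional :: "(real \<times> real) set \<Rightarrow> bool" where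
  "unconditional A \<longleftrightarrow>
     (\<forall>x\<^sub>1 x\<^sub>2. (x\<^sub>1, x\<^sub>2) \<in> A \<longrightarrow>
        (\<forall>\<epsilon>\<^sub>1\<in>{-1, 1}. \<forall>\<epsilon>\<^sub>2\<in>{-1, 1}. (\<epsilon>\<^sub>1 * x\<^sub>1, \<epsilon>\<^sub>2 * x\<^sub>2) \<in> A))"

end

theory Submission
  imports Defs
begin

text \<open>By unconditionality everything happens in the positive quadrant, where the measure has density
\<open>exp (- x - y)\<close>. In the coordinates \<open>s = x + y\<close>, \<open>u = x / (x + y)\<close> it becomes the product of
the density \<open>s exp (- s)\<close> on the half-line and the uniform distribution on \<open>(0, 1)\<close>. Let
\<open>A\<^sub>u\<close> be the set of radii at which the ray with parameter \<open>u\<close> meets \<open>A\<close>, write \<open>\<gamma>\<close> for the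
density \<open>s exp (- s)\<close>, \<open>\<lambda>\<close> for the density \<open>exp (- s)\<close>, and \<open>P\<close> for the boundary measure
on the half-line with respect to \<open>\<gamma>\<close>. An \<open>\<ell>\<^sub>1\<close>-ball of radius \<open>h\<close> contains a
rectangle in these coordinates: within \<open>u \<le> 1/2\<close> one may change \<open>s\<close> by less than \<open>h\<close>
and at the same time multiply or divide \<open>u\<close> by a factor up to \<open>1 + h / s\<close>; within
\<open>u \<ge> 1/2\<close> the same holds with \<open>1 - u\<close> in place of \<open>u\<close>. The first motion contributes the
average of \<open>P(A\<^sub>u)\<close>. The second lets a slice at fixed \<open>s\<close> grow towards the diagonal
\<open>u = 1/2\<close> if it misses the diagonal, and away from it if it contains the diagonal; its growth is
proportional to the measure of those \<open>u\<close> that disagree with \<open>1/2\<close> about membership in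
the slice. Together, for closed \<open>A\<close>,
\<open>\<mu>\<^sup>+(A) \<ge> \<integral> P(A\<^sub>u) + \<bar>\<lambda>(A\<^sub>u) - \<lambda>(A\<^bsub>1/2\<^esub>)\<bar> du\<close>,
the integral being over \<open>0 < u < 1\<close>.

It remains to bound the integrand for a single set \<open>C\<close> of radii. Let \<open>m = \<mu>(A)\<close> and
\<open>l = \<lambda>(A\<^bsub>1/2\<^esub>)\<close>, and let \<open>i\<close> be the boundary measure of the complement of a ball if
\<open>m \<le> 1/2\<close>, and of a ball if \<open>m > 1/2\<close>, of measure \<open>m\<close> in both cases. There is a slope
\<open>k\<close>, which may depend on \<open>m\<close> and \<open>l\<close> but not on \<open>C\<close>, with
\<open>P(C) + \<bar>\<lambda>(C) - l\<bar> \<ge> i + k (\<gamma>(C) - m)\<close>.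
Since the average of \<open>\<gamma>(A\<^sub>u)\<close> is \<open>m\<close>, integrating over \<open>u\<close> removes the slope term and leaves
\<open>i\<close>. To find \<open>k\<close>, substitute \<open>x = exp (- s)\<close>: then \<open>\<lambda>\<close> is Lebesgue measure on \<open>(0, 1)\<close>, and
\<open>s exp (- s)\<close>, the boundary cost of a point, is the concave function \<open>ent x = - x ln x\<close>.
Summing over the gaps of \<open>C\<close> and using concavity reduces the inequality to four kinds of slices:
the empty one, the full one, the segment \<open>[0, r]\<close> and the ray \<open>[r, \<infinity>)\<close> with \<open>\<lambda>\<close>-measure
\<open>l\<close>. The resulting system of four linear inequalities for \<open>k\<close> is \<open>admissible_slope\<close>,
and \<open>admissible_exists\<close> solves it. Complementation exchanges
the cases \<open>m \<le> 1/2\<close> and \<open>m > 1/2\<close>.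

The lemma \<open>slice_rate\<close> proves the inequality for one slice, \<open>enlargement_rate_closed\<close>
integrates it by Fatou's lemma for closed sets, and \<open>boundary_measure_ge\<close> passes to Borel sets:
enlargements do not distinguish a set from its closure, so if the closure has larger measure the
boundary measure is infinite.\<close>

section \<open>The function \<open>- x ln x\<close>\<close>

text \<open>With \<open>x = exp (- s)\<close> this is \<open>s exp (- s)\<close>, the density of the radius at \<open>s\<close>.\<close>

definition ent :: "real \<Rightarrow> real" where "ent x = - x * ln x"

lemma ent_0 [simp]: "ent 0 = 0" and ent_1 [simp]: "ent 1 = 0"
  by (simp_all add: ent_def)

lemma ent_nonneg: "0 \<le> x \<Longrightarrow> x \<le> 1 \<Longrightarrow> 0 \<le> ent x"
  by (cases "x = 0") (auto simp: ent_def mult_le_0_iff)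

lemma ent_tangent:
  assumes "0 \<le> x" "0 < a"
  shows "ent x \<le> a - x * (1 + ln a)"
proof (cases "x = 0")
  case False
  with assms have x: "0 < x" by simp
  have "ln (a / x) \<le> a / x - 1" by (rule ln_le_minus_one) (use x assms in simp)
  hence "x * ln (a / x) \<le> a - x" using x by (simp add: field_simps)
  thus ?thesis using x assms by (simp add: ent_def ln_div algebra_simps)
qed (use assms in auto)

lemma ent_concave:
  assumes "0 \<le> x" "0 \<le> y" "0 \<le> p" "0 \<le> q" "p + q = 1"
  shows "p * ent x + q * ent y \<le> ent (p * x + q * y)"
proof -
  let ?a = "p * x + q * y"
  show ?thesis
  proof (cases "?a = 0")
    case True
    hence "p * x = 0" "q * y = 0" using assms by (auto simp: add_nonneg_eq_0_iff)
    thus ?thesis using True by (auto simp: ent_def)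
  next
    case False
    hence a: "0 < ?a" using assms by (simp add: order_less_le)
    have "p * ent x + q * ent y \<le> p * (?a - x * (1 + ln ?a)) + q * (?a - y * (1 + ln ?a))"
      by (intro add_mono mult_left_mono ent_tangent a assms)
    also have "\<dots> = (p + q) * ?a - ?a * (1 + ln ?a)" by (simp add: algebra_simps)
    also have "\<dots> = ent ?a" using assms(5) by (simp add: ent_def algebra_simps)
    finally show ?thesis .
  qed
qed

lemma convex_weights:
  fixes x y z :: real
  assumes "x \<le> z" "z \<le> y"
  obtains p q where "0 \<le> p" "0 \<le> q" "p + q = 1" "z = p * x + q * y"
proof (cases "x = y")
  case True
  with assms show ?thesis by (intro that[of 1 0]) auto
next
  case False
  with assms have xy: "x < y" by simp
  define q where "q = (z - x) / (y - x)"
  have "0 \<le> q" "q \<le> 1" and "q * (y - x) = z - x" using assms xy by (simp_all add: q_def)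
  thus ?thesis by (intro that[of "1 - q" q]) (auto simp: algebra_simps)
qed

lemma ent_ge_min:
  assumes "0 \<le> x" "x \<le> z" "z \<le> y" "c \<le> ent x" "c \<le> ent y"
  shows "c \<le> ent z"
proof -
  obtain p q where pq: "0 \<le> p" "0 \<le> q" "p + q = 1" "z = p * x + q * y"
    using convex_weights assms(2,3) by blast
  have "c = p * c + q * c" using pq(3) by (simp flip: distrib_right)
  also have "\<dots> \<le> p * ent x + q * ent y"
    by (intro add_mono mult_left_mono) (use assms pq in auto)
  also have "\<dots> \<le> ent z" unfolding pq(4) by (rule ent_concave) (use assms pq in auto)
  finally show ?thesis .
qed

lemma ent_le_compl: "0 \<le> x \<Longrightarrow> ent x \<le> 1 - x"
  using ent_tangent[of x 1] by simp

text \<open>The difference of the two sides has derivative \<open>ln (1 - w\<^sup>2) \<le> 0\<close>.\<close>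

lemma ln_odd_bound:
  assumes "0 \<le> w" "w \<le> 1"
  shows "(1 + w) * ln (1 + w) - (1 - w) * ln (1 - w) \<le> 2 * (w::real)"
proof (cases "w = 1")
  case True
  thus ?thesis using ln_2_less_1 by simp
next
  case False
  with assms have w: "w < 1" by simp
  define g where "g = (\<lambda>w::real. (1 + w) * ln (1 + w) - (1 - w) * ln (1 - w) - 2 * w)"
  have "g w \<le> g 0"
  proof (rule DERIV_nonpos_imp_nonincreasing[OF assms(1)])
    fix x assume x: "0 \<le> x" "x \<le> w"
    have "(g has_real_derivative ln (1 + x) + ln (1 - x)) (at x)"
      unfolding g_def using x w by (auto intro!: derivative_eq_intros)
    moreover have "ln (1 + x) + ln (1 - x) \<le> 0"
      using ln_le_minus_one[of "1 + x"] ln_le_minus_one[of "1 - x"] x w by simp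
    ultimately show "\<exists>y. (g has_real_derivative y) (at x) \<and> y \<le> 0" by blast
  qed
  thus ?thesis by (simp add: g_def)
qed

text \<open>The derivative \<open>- 1 - ln\<close> is convex, so its mean over an interval is at least its value
at the midpoint.\<close>

lemma ent_slope:
  assumes "0 \<le> x" "x < y"
  shows "(y - x) * (- 1 - ln ((x + y) / 2)) \<le> ent y - ent x"
proof -
  define M where "M = (x + y) / 2"
  define w where "w = (y - x) / (x + y)"
  have M: "0 < M" and w: "0 \<le> w" "w \<le> 1" using assms by (auto simp: M_def w_def)
  have y: "y = M * (1 + w)" and x: "x = M * (1 - w)"
    using assms by (auto simp: M_def w_def field_simps)
  have e1: "ent y = - M * (1 + w) * ln M - M * ((1 + w) * ln (1 + w))"
    using M w unfolding ent_def y by (subst ln_mult) (auto simp: algebra_simps)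
  have e2: "ent x = - M * (1 - w) * ln M - M * ((1 - w) * ln (1 - w))"
  proof (cases "w = 1")
    case False
    with w M show ?thesis unfolding ent_def x by (subst ln_mult) (auto simp: algebra_simps)
  qed (simp add: x)
  have "ent y - ent x = - 2 * M * w * ln M - M * ((1 + w) * ln (1 + w) - (1 - w) * ln (1 - w))"
    unfolding e1 e2 by (simp add: algebra_simps)
  also have "\<dots> \<ge> - 2 * M * w * ln M - M * (2 * w)"
    by (intro diff_left_mono mult_left_mono ln_odd_bound) (use M w in auto)
  also have "- 2 * M * w * ln M - M * (2 * w) = (y - x) * (- 1 - ln M)"
    unfolding x y by (simp add: algebra_simps)
  finally show ?thesis by (simp add: M_def)
qed

lemma ln_numeric_bounds: "0.69 < ln (2::real)" "1.5 \<le> ln (5::real)" "1.04 \<le> ln (20/7::real)"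
    "0.28 \<le> ln (4/3::real)"
  using ln_approx_bounds[of 2 2] ln_approx_bounds[of 5 5] ln_approx_bounds[of "20/7" 4]
    ln_approx_bounds[of "4/3" 2] by (simp_all add: eval_nat_numeral)

text \<open>The inequality compares the chord slope of \<^const>\<open>ent\<close> between \<open>x\<close> and \<open>l\<close> with
\<open>(ent l - ent (1 - l)) / (2 ent (1 - l))\<close>; it is what makes the slope chosen in
\<open>admissible_middle\<close> small enough. For \<open>l \<le> 1/4\<close> the derivative of \<^const>\<open>ent\<close> at \<open>l\<close> is
already a sufficient lower bound for the chord slope.\<close>

lemma slope_gain_small:
  assumes "0 \<le> x" "x < l" "l \<le> 1/4"
  shows "(ent l - ent (1 - l)) * (l - x) \<le> 2 * ent (1 - l) * (ent l - ent x)"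
proof -
  define r where "r = - ln l"
  have l: "0 < l" using assms by simp
  have "ln l \<le> ln (1/4)" using l assms by simp
  also have "ln (1/4::real) = - 2 * ln 2" using ln_realpow[of 2 2] by (simp add: ln_div)
  finally have r: "1.38 \<le> r" using ln_numeric_bounds by (simp add: r_def)
  have q: "0.84 * l \<le> ent (1 - l)"
  proof -
    have "0.84 * l \<le> 4 * l * ent (3/4)"
    proof -
      have "ln (3/4) \<le> (-0.28::real)" using ln_numeric_bounds(4) by (simp add: ln_div)
      thus ?thesis using l mult_left_mono[of "ln (3/4)" "-0.28" l] by (simp add: ent_def)
    qed
    also have "\<dots> = 4 * l * ent (3/4) + (1 - 4 * l) * ent 1" by simp
    also have "\<dots> \<le> ent (4 * l * (3/4) + (1 - 4 * l) * 1)"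
      by (rule ent_concave) (use l assms in auto)
    finally show ?thesis by simp
  qed
  have el: "ent l = l * r" by (simp add: ent_def r_def)
  have slope: "(l - x) * (r - 1) \<le> ent l - ent x"
    using ent_tangent[of x l] assms l by (simp add: el r_def algebra_simps)
  have "l * r \<le> 0.84 * l * (2 * r - 1)" using r l by simp
  also have "\<dots> \<le> ent (1 - l) * (2 * r - 1)" by (intro mult_right_mono q) (use r in auto)
  finally have "ent l - ent (1 - l) \<le> 2 * ent (1 - l) * (r - 1)"
    by (simp add: el algebra_simps)
  hence "(ent l - ent (1 - l)) * (l - x) \<le> 2 * ent (1 - l) * (r - 1) * (l - x)"
    by (rule mult_right_mono) (use assms in auto)
  also have "\<dots> = 2 * ent (1 - l) * ((l - x) * (r - 1))" by simp
  also have "\<dots> \<le> 2 * ent (1 - l) * (ent l - ent x)"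
    by (intro mult_left_mono slope) (use ent_nonneg[of "1 - l"] assms in auto)
  finally show ?thesis .
qed

text \<open>Near \<open>l = 1/2\<close> the derivative at \<open>l\<close> is negative while the chord slope is still positive,
so the midpoint estimate takes its place. It is not sharp, which is affordable because
\<open>x \<le> 1/5\<close> stays away from \<open>1/4\<close>: there \<open>ent (1/4) = ent (1/2)\<close> would turn the inequality
at \<open>l = 1/2\<close> into an equality.\<close>

lemma slope_gain_large:
  assumes x: "0 \<le> x" "x \<le> 1/5" "1/4 \<le> l" "l \<le> 1/2"
  shows "(ent l - ent (1 - l)) * (l - x) \<le> 2 * ent (1 - l) * (ent l - ent x)"
proof -
  define z where "z = 1 - 2 * l"
  define a where "a = ln (2::real)"
  have a: "0.69 < a" "a < 1" using ln_numeric_bounds ln_2_less_1 by (auto simp: a_def)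
  have z: "0 \<le> z" "z \<le> 1/2" using assms by (auto simp: z_def)
  have l: "l = (1 - z) / 2" "1 - l = (1 + z) / 2" by (auto simp: z_def)
  have el: "ent l = ((1 - z) * a - (1 - z) * ln (1 - z)) / 2"
    and el': "ent (1 - l) = ((1 + z) * a - (1 + z) * ln (1 + z)) / 2"
    unfolding ent_def l a_def using z by (auto simp: ln_div field_simps)
  have d: "ent l - ent (1 - l) \<le> (1 - a) * z"
    using ln_odd_bound[of z] z unfolding el el' by (simp add: field_simps)
  have p: "(1 + z) * a - z - z\<^sup>2 / 2 \<le> 2 * ent (1 - l)"
  proof -
    have "z + z\<^sup>2 / 2 - (1 + z) * ln (1 + z) \<ge> (\<lambda>z. z + z\<^sup>2 / 2 - (1 + z) * ln (1 + z)) (0::real)"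
    proof (rule DERIV_nonneg_imp_nondecreasing[OF z(1)])
      fix x :: real assume x: "0 \<le> x" "x \<le> z"
      have "((\<lambda>z. z + z\<^sup>2 / 2 - (1 + z) * ln (1 + z)) has_real_derivative x - ln (1 + x)) (at x)"
        using x by (auto intro!: derivative_eq_intros)
      moreover have "ln (1 + x) \<le> x" using x by (simp add: ln_add_one_self_le_self)
      ultimately show "\<exists>y. ((\<lambda>z. z + z\<^sup>2 / 2 - (1 + z) * ln (1 + z)) has_real_derivative y) (at x) \<and> 0 \<le> y"
        by auto
    qed
    thus ?thesis unfolding el' by simp
  qed
  (* By \<open>x \<le> 1/5\<close> the midpoint \<open>(x + l) / 2\<close> is at most \<open>7/20 (1 - 5 z / 7)\<close>. *)
  have s: "(l - x) * (0.04 + 5 / 7 * z) \<le> ent l - ent x"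
  proof -
    have eq: "7 / 20 * (1 - 5 / 7 * z) = 1 / 10 + l / 2" by (simp add: z_def field_simps)
    have "ln ((x + l) / 2) \<le> ln (7 / 20 * (1 - 5 / 7 * z))"
      unfolding eq using assms by simp
    also have "\<dots> = ln (1 - 5 / 7 * z) - ln (20 / 7)"
      using z by (subst ln_mult) (auto simp: ln_div)
    also have "\<dots> \<le> - 5 / 7 * z - 1.04"
      using ln_le_minus_one[of "1 - 5 / 7 * z"] ln_numeric_bounds(3) z by simp
    finally have "(l - x) * (0.04 + 5 / 7 * z) \<le> (l - x) * (- 1 - ln ((x + l) / 2))"
      by (intro mult_left_mono) (use assms in auto)
    also have "\<dots> \<le> ent l - ent x" by (rule ent_slope) (use assms in auto)
    finally show ?thesis .
  qed
  have "(1 - a) * z \<le> 0.31 * z" using a z by (intro mult_right_mono) auto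
  also have "0.31 * z \<le> (0.69 * (1 + z) - z - z\<^sup>2 / 2) * (0.04 + 5 / 7 * z)"
  proof -
    define z2 z3 where "z2 = z * z" and "z3 = z * z * z"
    have "z2 \<le> z * (1/2)" "z3 \<le> z * (1/2) * (1/2)"
      unfolding z2_def z3_def using z by (intro mult_mono; simp)+
    moreover have "(0.69 * (1 + z) - z - z\<^sup>2 / 2) * (0.04 + 5 / 7 * z) =
       0.0276 + (0.69 * 5 / 7 - 0.0124) * z - (0.02 + 0.31 * 5 / 7) * z2 - 5 / 14 * z3"
      by (simp add: field_simps power2_eq_square z2_def z3_def)
    ultimately show ?thesis using z by simp
  qed
  also have "\<dots> \<le> ((1 + z) * a - z - z\<^sup>2 / 2) * (0.04 + 5 / 7 * z)"
    using a z mult_right_mono[of "0.69" a "1 + z"]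
    by (intro mult_right_mono) (auto simp: mult.commute[of a])
  also have "\<dots> \<le> 2 * ent (1 - l) * (0.04 + 5 / 7 * z)"
    by (intro mult_right_mono p) (use z in auto)
  finally have "ent l - ent (1 - l) \<le> 2 * ent (1 - l) * (0.04 + 5 / 7 * z)" using d by simp
  hence "(ent l - ent (1 - l)) * (l - x) \<le> 2 * ent (1 - l) * (0.04 + 5 / 7 * z) * (l - x)"
    by (rule mult_right_mono) (use assms in auto)
  also have "\<dots> = 2 * ent (1 - l) * ((l - x) * (0.04 + 5 / 7 * z))" by simp
  also have "\<dots> \<le> 2 * ent (1 - l) * (ent l - ent x)"
    by (intro mult_left_mono s) (use ent_nonneg[of "1 - l"] assms in auto)
  finally show ?thesis .
qed

section \<open>Supporting slopes\<close>

text \<open>The four inequalities say that \<open>P(C) + \<bar>\<lambda>(C) - l\<bar> \<ge> i + k (\<gamma>(C) - m)\<close> holds for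
the empty slice, for the full half-line, for the ray \<open>[r, \<infinity>)\<close> with \<open>exp (- r) = l\<close> and for
the segment \<open>[0, r]\<close> with \<open>exp (- r) = 1 - l\<close>, in this order.\<close>

definition admissible_slope :: "real \<Rightarrow> real \<Rightarrow> real \<Rightarrow> real \<Rightarrow> bool" where
  "admissible_slope i m l k \<longleftrightarrow> -1 \<le> k \<and> k \<le> 1 \<and>
     i - l \<le> k * m \<and> k * (1 - m) \<le> 1 - l - i \<and>
     i \<le> (1 - k) * ent l + k * (m - l) \<and> i \<le> (1 + k) * ent (1 - l) + k * (m - l)"

text \<open>Complementing all slices preserves boundaries and exchanges the empty slice with the full
one, and rays with segments.\<close>

lemma admissible_flip: "admissible_slope i m l k \<Longrightarrow> admissible_slope i (1 - m) (1 - l) (- k)"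
  by (auto simp: admissible_slope_def algebra_simps)

text \<open>Up to complementation this is the only delicate range of \<open>l\<close>: the segment of \<open>\<lambda>\<close>-measure \<open>l\<close> has
boundary less than \<open>ent x\<close>, so the slope must be positive to make up for it, but not so large
that the ray of the same \<open>\<lambda>\<close>-measure fails.\<close>

lemma admissible_middle:
  assumes x: "0 \<le> x" "x \<le> 1/5" "x < l" "l \<le> 1/2" "x + ent x \<le> m"
    and less: "ent (1 - l) < ent x" "ent x \<le> ent l"
  shows "\<exists>k. admissible_slope (ent x) m l k"
proof -
  define i where "i = ent x"
  define e where "e = ent (1 - l)"
  (* For \<open>m = x + i\<close> this slope makes the inequality for the segment an equality. A larger
     \<open>m\<close> only relaxes the four inequalities, because the slope is nonnegative. *)
  define k where "k = (i - e) / (i + x - l + e)"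
  have e: "l / 2 \<le> e"
  proof -
    have "(1 - l) * ln (1 - l) \<le> (1 - l) * - l"
      using ln_le_minus_one[of "1 - l"] x by (intro mult_left_mono) auto
    hence "l * (1 - l) \<le> e" by (simp add: e_def ent_def algebra_simps)
    moreover have "l * (1/2) \<le> l * (1 - l)" using x by (intro mult_left_mono) auto
    ultimately show ?thesis by simp
  qed
  have el: "e \<le> l" using ent_le_compl[of "1 - l"] x by (simp add: e_def)
  have den: "0 < i + x - l + e" using e less x by (simp add: i_def e_def)
  have k0: "0 \<le> k" using den less by (simp add: k_def i_def e_def)
  have kd: "k * (i + x - l + e) = i - e" using den by (simp add: k_def)
  have "(ent l - e) * (l - x) \<le> 2 * e * (ent l - i)"
    using slope_gain_small[of x l] slope_gain_large[of x l] x unfolding e_def i_def by linarith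
  hence "(i - e) * (ent l - i + (l - x)) \<le> (ent l - i) * (i + x - l + e)"
    by (simp add: algebra_simps)
  hence kc: "k * (ent l - i + (l - x)) \<le> ent l - i"
    using den by (simp add: k_def pos_divide_le_eq)
  have k1: "k \<le> 1"
  proof (rule ccontr)
    assume "\<not> k \<le> 1"
    hence "1 * (ent l - i + (l - x)) < k * (ent l - i + (l - x))"
      using less x by (intro mult_strict_right_mono) (auto simp: i_def)
    thus False using kc x by simp
  qed
  have mk: "k * (x + i) \<le> k * m" using k0 x by (intro mult_left_mono) (auto simp: i_def)
  have a: "i - l \<le> k * m"
  proof -
    have "k * (i + x - l + e) \<le> k * (x + i)" using k0 el by (intro mult_left_mono) auto
    thus ?thesis using kd mk el by simp
  qed
  have "k * (1 - (x + i)) \<le> 1 - l - i"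
  proof -
    have "ent l - i + (l - x) \<le> 1 - x - i" using ent_le_compl[of l] x by simp
    hence "(1 - k) * (ent l - i + (l - x)) \<le> (1 - k) * (1 - x - i)" using k1 by (intro mult_left_mono) auto
    thus ?thesis using kc by (simp add: algebra_simps)
  qed
  hence b: "k * (1 - m) \<le> 1 - l - i" using mk by (simp add: algebra_simps)
  have c: "i \<le> (1 - k) * ent l + k * (m - l)" using kc mk by (simp add: algebra_simps)
  have d: "i \<le> (1 + k) * e + k * (m - l)" using kd mk by (simp add: algebra_simps)
  show ?thesis using a b c d k0 k1 unfolding admissible_slope_def i_def e_def by (intro exI[of _ k]) auto
qed

text \<open>Here \<open>x = exp (- r)\<close>, or \<open>x = 0\<close> for \<open>r = \<infinity>\<close>, where \<open>m = x + ent x\<close> is the measure of the complement of the ball of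
radius \<open>r\<close> and \<open>ent x\<close> its boundary measure. For extreme \<open>l\<close> the slopes \<open>1\<close> and \<open>- 1\<close>
work, and in between slope \<open>0\<close> works if segment and ray both have boundary at least \<open>ent x\<close>. The two
remaining cases are \<open>admissible_middle\<close> and its mirror image.\<close>

lemma admissible_exists:
  assumes x: "0 \<le> x" "x \<le> 1" "x + ent x = m" "m \<le> 1/2" and l: "0 \<le> l" "l \<le> 1"
  shows "\<exists>k. admissible_slope (ent x) m l k"
proof -
  (* \<open>x + ent x\<close> increases and exceeds \<open>1/2\<close> at \<open>1/5\<close>. *)
  have x5: "x \<le> 1/5"
  proof (rule ccontr)
    assume "\<not> x \<le> 1/5"
    hence 1: "1/5 < x" by simp
    have "ent (1/5) \<ge> 0.3" using ln_numeric_bounds(2) by (simp add: ent_def ln_div)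
    hence "1/2 \<le> (\<lambda>x. x + ent x) (1/5)" by simp
    also have "\<dots> < (\<lambda>x. x + ent x) x"
    proof (rule DERIV_pos_imp_increasing_open[OF 1])
      fix y assume y: "1/5 < y" "y < x"
      have "((\<lambda>x. x + ent x) has_real_derivative - ln y) (at y)"
        unfolding ent_def using y by (auto intro!: derivative_eq_intros)
      thus "\<exists>z. ((\<lambda>x. x + ent x) has_real_derivative z) (at y) \<and> 0 < z"
        using y x by (intro exI[of _ "- ln y"]) auto
    qed (auto simp: ent_def intro!: continuous_intros)
    finally show False using x by simp
  qed
  have i0: "0 \<le> ent x" using x by (simp add: ent_nonneg)
  have ent12: "ent (1/2) = ln 2 / 2" "ent (1/4) = ln 2 / 2"
    using ln_realpow[of 2 2] by (simp_all add: ent_def ln_div)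
  have half: "ent x \<le> ent (1/2)"
  proof -
    have "ent x \<le> 1/4 - x * (1 + ln (1/4))" by (rule ent_tangent) (use x in auto)
    also have "\<dots> = 1/4 + x * (2 * ln 2 - 1)" using ln_realpow[of 2 2] by (simp add: ln_div algebra_simps)
    also have "\<dots> \<le> 1/4 + 1/4 * (2 * ln 2 - 1)"
      using ln_numeric_bounds(1) x5 by (intro add_left_mono mult_right_mono) auto
    also have "\<dots> = ent (1/2)" by (simp add: ent12 field_simps)
    finally show ?thesis .
  qed
  (* \<open>ent\<close> rises and then falls on \<open>[x, 1/2]\<close>, so only the endpoints matter. *)
  have mid: "ent x \<le> ent y" if "x \<le> y" "y \<le> 1/2" for y
    by (rule ent_ge_min[of x _ "1/2"]) (use half x that in auto)
  consider "l \<le> x" | "m + ent x \<le> l" | "x < l" "l < m + ent x" "ent x \<le> ent l" "ent x \<le> ent (1 - l)"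
    | "x < l" "l < m + ent x" "ent (1 - l) < ent x" | "x < l" "l < m + ent x" "ent l < ent x"
    by linarith
  thus ?thesis
  proof cases
    case 1
    hence "admissible_slope (ent x) m l 1" using x ent_nonneg[of "1 - l"] l by (auto simp: admissible_slope_def)
    thus ?thesis ..
  next
    case 2
    hence "admissible_slope (ent x) m l (-1)" using x ent_nonneg[of l] l i0 by (auto simp: admissible_slope_def)
    thus ?thesis ..
  next
    case 3
    hence "admissible_slope (ent x) m l 0"
      using ent_le_compl[of l] ent_le_compl[of "1 - l"] l by (auto simp: admissible_slope_def)
    thus ?thesis ..
  next
    case 4
    have "l \<le> 1/2"
      using mid[of "1 - l"] 4 x i0 by (cases "l \<le> 1/2") auto
    thus ?thesis using admissible_middle[of x l m] 4 x x5 mid[of l] by auto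
  next
    case 5
    have "1/2 \<le> l" using mid[of l] 5 by (cases "l \<le> 1/2") auto
    hence "\<exists>k. admissible_slope (ent x) (1 - m) (1 - l) k"
      using admissible_middle[of x "1 - l" "1 - m"] 5 x x5 mid[of "1 - l"] by auto
    thus ?thesis using admissible_flip[of "ent x" "1 - m" "1 - l"] by auto
  qed
qed

text \<open>Here \<open>y\<close> is the \<open>\<lambda>\<close>-measure of the complement of a slice. Each of the two expressions
under the minimum makes the right-hand side concave in \<open>y\<close> on \<open>[0, 1 - l]\<close> and on
\<open>[1 - l, 1]\<close>, so the inequality needs to be checked only at \<open>0\<close>, \<open>1 - l\<close> and \<open>1\<close>; that
is what admissibility provides.\<close>

lemma admissible_profile:
  assumes adm: "admissible_slope i m l k" and y: "0 \<le> y" "y \<le> 1" and l: "0 \<le> l" "l \<le> 1"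
  shows "i - k * m \<le> min ((1 + k) * ent y) ((1 - k) * ent (1 - y)) + k * y - k + \<bar>1 - y - l\<bar>"
proof -
  have main: "i + k * (1 - m) \<le> (1 + k) * ent y + k * y + \<bar>1 - y - l\<bar>"
    if k: "-1 \<le> k" "k \<le> 1" and a: "i - l \<le> k * m" and b: "k * (1 - m) \<le> 1 - l - i"
      and d: "i \<le> (1 + k) * ent (1 - l) + k * (m - l)" and y: "0 \<le> y" "y \<le> 1" and l: "0 \<le> l" "l \<le> 1"
    for k m l y :: real
  proof (cases "y \<le> 1 - l")
    case True
    obtain p q where pq: "0 \<le> p" "0 \<le> q" "p + q = 1" "y = p * 0 + q * (1 - l)"
      using convex_weights[of 0 y "1 - l"] True y by blast
    have e: "i + k * (1 - m) \<le> (1 + k) * ent 0 + (1 - l)"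
      "i + k * (1 - m) \<le> (1 + k) * ent (1 - l) + k * (1 - l)"
      using b d by (auto simp: algebra_simps)
    have "i + k * (1 - m) = p * (i + k * (1 - m)) + q * (i + k * (1 - m))"
      using pq(3) by (simp flip: distrib_right)
    also have "\<dots> \<le> p * ((1 + k) * ent 0 + (1 - l)) + q * ((1 + k) * ent (1 - l) + k * (1 - l))"
      by (intro add_mono[OF mult_left_mono mult_left_mono] e pq)
    also have "\<dots> = (1 + k) * (p * ent 0 + q * ent (1 - l)) + (p * (1 - l) + k * q * (1 - l))"
      by (simp add: algebra_simps)
    also have "p * (1 - l) = 1 - y - l"
    proof -
      have p: "p = 1 - q" using pq(3) by simp
      show ?thesis unfolding pq(4) p by (simp add: algebra_simps)
    qed
    also have "(1 + k) * (p * ent 0 + q * ent (1 - l)) \<le> (1 + k) * ent y"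
      unfolding pq(4) by (intro mult_left_mono ent_concave) (use pq k l in auto)
    also have "k * q * (1 - l) = k * y" using pq(4) by simp
    finally show ?thesis using True by (simp add: algebra_simps)
  next
    case False
    obtain p q where pq: "0 \<le> p" "0 \<le> q" "p + q = 1" "y = p * 1 + q * (1 - l)"
      using convex_weights[of "1 - l" y 1] False y by (metis add.commute linorder_le_cases)
    have e: "i + k * (1 - m) \<le> (1 + k) * ent 1 + (k + l)"
      "i + k * (1 - m) \<le> (1 + k) * ent (1 - l) + k * (1 - l)"
      using a d by (auto simp: algebra_simps)
    have "i + k * (1 - m) = p * (i + k * (1 - m)) + q * (i + k * (1 - m))"
      using pq(3) by (simp flip: distrib_right)
    also have "\<dots> \<le> p * ((1 + k) * ent 1 + (k + l)) + q * ((1 + k) * ent (1 - l) + k * (1 - l))"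
      by (intro add_mono[OF mult_left_mono mult_left_mono] e pq)
    also have "\<dots> = (1 + k) * (p * ent 1 + q * ent (1 - l)) + (p * l + k * (p + q * (1 - l)))"
      by (simp add: algebra_simps)
    also have "p * l = y + l - 1"
    proof -
      have p: "p = 1 - q" using pq(3) by simp
      show ?thesis unfolding pq(4) p by (simp add: algebra_simps)
    qed
    also have "(1 + k) * (p * ent 1 + q * ent (1 - l)) \<le> (1 + k) * ent y"
      unfolding pq(4) by (intro mult_left_mono ent_concave) (use pq k l in auto)
    also have "p + q * (1 - l) = y" using pq(4) by simp
    finally show ?thesis using False by (simp add: algebra_simps)
  qed
  have "i + k * (1 - m) \<le> (1 + k) * ent y + k * y + \<bar>1 - y - l\<bar>"
    by (rule main) (use adm y l in \<open>auto simp: admissible_slope_def\<close>)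
  moreover have "i + (- k) * (1 - (1 - m)) \<le> (1 + (- k)) * ent (1 - y) + (- k) * (1 - y) + \<bar>1 - (1 - y) - (1 - l)\<bar>"
    using admissible_flip[OF adm] y l
    by (intro main) (auto simp: admissible_slope_def)
  ultimately show ?thesis by (simp add: algebra_simps min_def abs_minus_commute)
qed

section \<open>Radial measures\<close>

text \<open>The distribution of the \<open>\<ell>\<^sub>1\<close>-norm.\<close>

definition gamma2 :: "real measure" where
  "gamma2 = density lborel (\<lambda>s. ennreal (s * exp (- s)) * indicator {0..} s)"

text \<open>The weight \<open>exp (- s)\<close> of a slice at radius \<open>s\<close> when its \<open>\<gamma>\<close>-density \<open>s exp (- s)\<close>
is multiplied by the rate \<open>1 / s\<close> of the motion across rays.\<close>

definition expo :: "real measure" where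
  "expo = density lborel (\<lambda>s. ennreal (exp (- s)) * indicator {0..} s)"

lemma sets_gamma2 [simp, measurable_cong]: "sets gamma2 = sets borel"
  and space_gamma2 [simp]: "space gamma2 = UNIV"
  and sets_expo [simp, measurable_cong]: "sets expo = sets borel"
  and space_expo [simp]: "space expo = UNIV"
  by (simp_all add: gamma2_def expo_def)

definition gamma2_prim :: "real \<Rightarrow> real" where "gamma2_prim s = - (1 + s) * exp (- s)"
definition expo_prim :: "real \<Rightarrow> real" where "expo_prim s = - exp (- s)"

lemma gamma2_prim_deriv: "(gamma2_prim has_real_derivative s * exp (- s)) (at s)"
  unfolding gamma2_prim_def [abs_def] by (auto intro!: derivative_eq_intros simp: algebra_simps)

lemma expo_prim_deriv: "(expo_prim has_real_derivative exp (- s)) (at s)"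
  unfolding expo_prim_def [abs_def] by (auto intro!: derivative_eq_intros simp: algebra_simps)

lemma prim_at_top: "(gamma2_prim \<longlongrightarrow> 0) at_top" "(expo_prim \<longlongrightarrow> 0) at_top"
proof -
  have 1: "((\<lambda>x::real. exp (- x)) \<longlongrightarrow> 0) at_top"
    using tendsto_power_div_exp_0[of 0] by (simp add: exp_minus field_simps)
  have 2: "((\<lambda>x::real. x * exp (- x)) \<longlongrightarrow> 0) at_top"
    using tendsto_power_div_exp_0[of 1] by (simp add: exp_minus field_simps)
  show "(expo_prim \<longlongrightarrow> 0) at_top"
    using tendsto_minus[OF 1] by (simp add: expo_prim_def [abs_def])
  show "(gamma2_prim \<longlongrightarrow> 0) at_top"
    using tendsto_diff[OF tendsto_minus[OF 1] 2] by (simp add: gamma2_prim_def [abs_def] left_diff_distrib)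
qed

lemma emeasure_Icc:
  assumes "0 \<le> a" "a \<le> b"
  shows "emeasure gamma2 {a..b} = ennreal (gamma2_prim b - gamma2_prim a)"
    and "emeasure expo {a..b} = ennreal (expo_prim b - expo_prim a)"
proof -
  have "emeasure gamma2 {a..b} = (\<integral>\<^sup>+s. ennreal (s * exp (- s)) * indicator {a..b} s \<partial>lborel)"
    unfolding gamma2_def by (subst emeasure_density) (use assms in \<open>auto intro!: nn_integral_cong simp: indicator_def\<close>)
  also have "\<dots> = ennreal (gamma2_prim b - gamma2_prim a)"
    by (rule nn_integral_FTC_Icc) (use assms gamma2_prim_deriv in auto)
  finally show "emeasure gamma2 {a..b} = ennreal (gamma2_prim b - gamma2_prim a)" .
  have "emeasure expo {a..b} = (\<integral>\<^sup>+s. ennreal (exp (- s)) * indicator {a..b} s \<partial>lborel)"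
    unfolding expo_def by (subst emeasure_density) (use assms in \<open>auto intro!: nn_integral_cong simp: indicator_def\<close>)
  also have "\<dots> = ennreal (expo_prim b - expo_prim a)"
    by (rule nn_integral_FTC_Icc) (use assms expo_prim_deriv in auto)
  finally show "emeasure expo {a..b} = ennreal (expo_prim b - expo_prim a)" .
qed

lemma emeasure_Ici:
  assumes "0 \<le> a"
  shows "emeasure gamma2 {a..} = ennreal (- gamma2_prim a)"
    and "emeasure expo {a..} = ennreal (- expo_prim a)"
proof -
  have "emeasure gamma2 {a..} = (\<integral>\<^sup>+s. ennreal (s * exp (- s)) * indicator {a..} s \<partial>lborel)"
    unfolding gamma2_def by (subst emeasure_density) (use assms in \<open>auto intro!: nn_integral_cong simp: indicator_def\<close>)
  also have "\<dots> = ennreal (0 - gamma2_prim a)"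
    by (rule nn_integral_FTC_atLeast) (use assms gamma2_prim_deriv prim_at_top in auto)
  finally show "emeasure gamma2 {a..} = ennreal (- gamma2_prim a)" by simp
  have "emeasure expo {a..} = (\<integral>\<^sup>+s. ennreal (exp (- s)) * indicator {a..} s \<partial>lborel)"
    unfolding expo_def by (subst emeasure_density) (use assms in \<open>auto intro!: nn_integral_cong simp: indicator_def\<close>)
  also have "\<dots> = ennreal (0 - expo_prim a)"
    by (rule nn_integral_FTC_atLeast) (use assms expo_prim_deriv prim_at_top in auto)
  finally show "emeasure expo {a..} = ennreal (- expo_prim a)" by simp
qed

lemma emeasure_nonneg_part: "emeasure gamma2 X = emeasure gamma2 (X \<inter> {0..})" "emeasure expo X = emeasure expo (X \<inter> {0..})"
  if "X \<in> sets borel" for X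
  using that unfolding gamma2_def expo_def
  by (simp_all add: emeasure_density, auto intro!: nn_integral_cong split: split_indicator)

lemma emeasure_UNIV: "emeasure gamma2 UNIV = 1" "emeasure expo UNIV = 1"
  using emeasure_nonneg_part[of UNIV] emeasure_Ici[of 0]
  by (simp_all add: gamma2_prim_def expo_prim_def)

lemma finite_measures: "finite_measure gamma2" "finite_measure expo"
  by (auto intro!: finite_measureI simp: emeasure_UNIV)

interpretation gamma2: finite_measure gamma2 by (rule finite_measures)
interpretation expo: finite_measure expo by (rule finite_measures)

lemma measure_UNIV_1: "measure gamma2 UNIV = 1" "measure expo UNIV = 1"
  by (simp_all add: measure_def emeasure_UNIV)

lemma null_singleton: "{x} \<in> null_sets gamma2" "{x} \<in> null_sets expo"
proof -
  have "emeasure gamma2 {x} = 0 \<and> emeasure expo {x} = 0"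
  proof (cases "0 \<le> x")
    case True
    thus ?thesis using emeasure_Icc[of x x] by simp
  next
    case False
    hence "{x} \<inter> {0..} = {}" by auto
    thus ?thesis using emeasure_nonneg_part[of "{x}"] by (simp only: ) simp
  qed
  thus "{x} \<in> null_sets gamma2" "{x} \<in> null_sets expo" by (auto simp: null_sets_def)
qed

lemma emeasure_Ioo:
  assumes "0 \<le> a" "a \<le> b"
  shows "emeasure gamma2 {a<..<b} = ennreal (gamma2_prim b - gamma2_prim a)"
    and "emeasure expo {a<..<b} = ennreal (expo_prim b - expo_prim a)"
proof -
  have e: "{a<..<b} = {a..b} - ({a} \<union> {b})" by auto
  show "emeasure gamma2 {a<..<b} = ennreal (gamma2_prim b - gamma2_prim a)"
    "emeasure expo {a<..<b} = ennreal (expo_prim b - expo_prim a)"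
    unfolding e using assms
    by (subst emeasure_Diff_null_set; (intro null_sets.Un null_singleton)?; simp add: emeasure_Icc)+
qed

lemma emeasure_Ioi:
  assumes "0 \<le> a"
  shows "emeasure gamma2 {a<..} = ennreal (- gamma2_prim a)"
    and "emeasure expo {a<..} = ennreal (- expo_prim a)"
proof -
  have e: "{a<..} = {a..} - {a}" by auto
  show "emeasure gamma2 {a<..} = ennreal (- gamma2_prim a)" "emeasure expo {a<..} = ennreal (- expo_prim a)"
    unfolding e using assms
    by (subst emeasure_Diff_null_set; (intro null_sets.Un null_singleton)?; simp add: emeasure_Ici)+
qed

section \<open>Boundaries of closed sets of radii\<close>

definition thicken :: "real \<Rightarrow> real set \<Rightarrow> real set" where
  "thicken h C = {s. \<exists>s'\<in>C. \<bar>s - s'\<bar> < h}"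

lemma open_thicken: "open (thicken h C)"
proof -
  have "thicken h C = (\<Union>s'\<in>C. ball s' h)"
    by (auto simp: thicken_def dist_real_def abs_minus_commute)
  thus ?thesis by (simp only:) (intro open_UN ballI open_ball)
qed

text \<open>A lower bound for the boundary of a gap \<open>(a, b)\<close> of \<open>\<lambda>\<close>-measure \<open>y\<close>, corrected by
\<open>k (\<gamma> - \<lambda>)\<close> of the gap. The two arguments of the minimum are the values for gaps
\<open>(a, \<infinity>)\<close> and \<open>(0, b)\<close>.\<close>

definition gap_bound :: "real \<Rightarrow> real \<Rightarrow> real" where
  "gap_bound k y = min ((1 + k) * ent y) ((1 - k) * ent (1 - y))"

text \<open>Fix \<open>a - b\<close> and slide the interval inside \<open>[0, 1]\<close>. The right-hand side is concave in
the position, hence smallest when the interval touches \<open>0\<close> or \<open>1\<close>.\<close>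

lemma gap_bound_interval:
  assumes k: "-1 \<le> k" "k \<le> 1" and ab: "0 \<le> b" "b \<le> a" "a \<le> 1"
  shows "gap_bound k (a - b) \<le> (1 + k) * ent a + (1 - k) * ent b"
proof -
  define y where "y = a - b"
  have y: "0 \<le> y" "y \<le> 1" using ab by (auto simp: y_def)
  obtain p q where pq: "0 \<le> p" "0 \<le> q" "p + q = 1" "b = p * 0 + q * (1 - y)"
    using convex_weights[of 0 b "1 - y"] ab by (auto simp: y_def)
  have a: "a = p * y + q * 1"
  proof -
    have p: "p = 1 - q" using pq(3) by simp
    have "a = y + b" by (simp add: y_def)
    thus ?thesis unfolding pq(4) p by (simp add: algebra_simps)
  qed
  have "gap_bound k y = p * gap_bound k y + q * gap_bound k y" using pq(3) by (simp flip: distrib_right)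
  also have "\<dots> \<le> p * ((1 + k) * ent y) + q * ((1 - k) * ent (1 - y))"
    by (intro add_mono[OF mult_left_mono mult_left_mono] pq) (auto simp: gap_bound_def)
  also have "\<dots> = (1 + k) * (p * ent y + q * ent 1) + (1 - k) * (p * ent 0 + q * ent (1 - y))"
    by simp
  also have "\<dots> \<le> (1 + k) * ent a + (1 - k) * ent b"
    unfolding a pq(4) by (intro add_mono mult_left_mono ent_concave) (use pq y k in auto)
  finally show ?thesis by (simp add: y_def)
qed

text \<open>As a minimum of concave functions vanishing at \<open>0\<close>, \<^const>\<open>gap_bound\<close> is above its chords
from the origin. This linear lower bound can be summed over the gaps.\<close>

lemma gap_bound_star:
  assumes k: "-1 \<le> k" "k \<le> 1" and y: "0 \<le> y" "y \<le> z" "0 < z" "z \<le> 1"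
  shows "y * (gap_bound k z / z) \<le> gap_bound k y"
proof -
  define p where "p = y / z"
  have p: "0 \<le> p" "p \<le> 1" "y = p * z" using y by (auto simp: p_def)
  have "p * ent z + (1 - p) * ent 0 \<le> ent (p * z + (1 - p) * 0)"
    "p * ent (1 - z) + (1 - p) * ent 1 \<le> ent (p * (1 - z) + (1 - p) * 1)"
    by (rule ent_concave; use p y in simp)+
  hence e: "p * ent z \<le> ent y" "p * ent (1 - z) \<le> ent (1 - y)"
    using p by (simp_all add: algebra_simps)
  have "p * gap_bound k z \<le> p * ((1 + k) * ent z)" "p * gap_bound k z \<le> p * ((1 - k) * ent (1 - z))"
    by (intro mult_left_mono p; simp add: gap_bound_def)+
  moreover have "(1 + k) * (p * ent z) \<le> (1 + k) * ent y" "(1 - k) * (p * ent (1 - z)) \<le> (1 - k) * ent (1 - y)"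
    by (intro mult_left_mono e; use k in simp)+
  ultimately have "p * gap_bound k z \<le> gap_bound k y" by (simp add: gap_bound_def algebra_simps)
  thus ?thesis by (simp add: p_def)
qed

text \<open>An endpoint of a gap other than \<open>0\<close> lies in \<open>C\<close>, because otherwise the gap could be
extended. So \<open>C\<close> grows into the gap from each such endpoint.\<close>

lemma gap_cases:
  assumes C: "closed C" and K: "K \<in> components ({0<..} - C :: real set)"
  obtains (bounded) a b where "0 \<le> a" "a < b" "a = 0 \<or> a \<in> C" "b \<in> C" "K = {a<..<b}"
    | (unbounded) a where "0 \<le> a" "a = 0 \<or> a \<in> C" "K = {a<..}"
proof -
  let ?N = "{0<..} - C"
  have N: "open ?N" using C by (simp add: open_Diff)
  have oK: "open K" by (rule open_components[OF N K])
  have conn: "connected K" and ne: "K \<noteq> {}" and KN: "K \<subseteq> ?N"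
    using K by (auto dest: in_components_connected in_components_nonempty in_components_subset)
  have bdd: "bdd_below K" using KN by (intro bdd_belowI[of _ 0]) auto
  define a where "a = Inf K"
  have a0: "0 \<le> a" unfolding a_def by (rule cInf_greatest[OF ne]) (use KN in auto)
  have aK: "a \<notin> K"
  proof
    assume "a \<in> K"
    then obtain e where "e > 0" "ball a e \<subseteq> K" using oK open_contains_ball by blast
    hence "a - e / 2 \<in> K" by (auto simp: subset_iff dist_real_def)
    hence "a \<le> a - e / 2" unfolding a_def by (rule cInf_lower[OF _ bdd])
    thus False using \<open>e > 0\<close> by simp
  qed
  have maximal: "ball x e \<subseteq> K" if "ball x e \<subseteq> ?N" "y \<in> K" "y \<in> ball x e" for x e y
    by (rule components_maximal[OF K]) (use that in auto)
  have aC: "a = 0 \<or> a \<in> C"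
  proof (rule ccontr)
    assume "\<not> (a = 0 \<or> a \<in> C)"
    hence "a \<in> ?N" using a0 by simp
    then obtain e where e: "e > 0" "ball a e \<subseteq> ?N" using N open_contains_ball by blast
    obtain y where y: "y \<in> K" "y < a + e" using cInf_lessD[OF ne, of "a + e"] e by (auto simp: a_def)
    have "a \<le> y" unfolding a_def by (rule cInf_lower[OF y(1) bdd])
    hence "ball a e \<subseteq> K" by (intro maximal[OF e(2) y(1)]) (use y in \<open>auto simp: dist_real_def\<close>)
    thus False using aK e centre_in_ball by blast
  qed
  have inK: "x \<in> K" if "y \<in> K" "z \<in> K" "y \<le> x" "x \<le> z" for x y z
    using conn that unfolding connected_iff_interval by blast
  show thesis
  proof (cases "bdd_above K")
    case False
    have "K = {a<..}"
    proof (intro equalityI subsetI)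
      fix x assume "x \<in> K"
      hence "a \<le> x" unfolding a_def by (rule cInf_lower[OF _ bdd])
      thus "x \<in> {a<..}" using \<open>x \<in> K\<close> aK by (auto simp: order_less_le)
    next
      fix x assume "x \<in> {a<..}"
      then obtain y where "y \<in> K" "y < x" using cInf_lessD[OF ne, of x] by (auto simp: a_def)
      moreover obtain z where "z \<in> K" "x < z" using False by (meson bdd_above.I linorder_not_le)
      ultimately show "x \<in> K" using inK[of y z x] by auto
    qed
    thus ?thesis using unbounded a0 aC by blast
  next
    case True
    define b where "b = Sup K"
    have bK: "b \<notin> K"
    proof
      assume "b \<in> K"
      then obtain e where "e > 0" "ball b e \<subseteq> K" using oK open_contains_ball by blast
      hence "b + e / 2 \<in> K" by (auto simp: subset_iff dist_real_def)
      hence "b + e / 2 \<le> b" unfolding b_def by (rule cSup_upper[OF _ True])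
      thus False using \<open>e > 0\<close> by simp
    qed
    have Ke: "K = {a<..<b}"
    proof (intro equalityI subsetI)
      fix x assume "x \<in> K"
      hence "a \<le> x" "x \<le> b" unfolding a_def b_def by (auto intro: cInf_lower[OF _ bdd] cSup_upper[OF _ True])
      thus "x \<in> {a<..<b}" using \<open>x \<in> K\<close> aK bK by (auto simp: order_less_le)
    next
      fix x assume x: "x \<in> {a<..<b}"
      then obtain y where "y \<in> K" "y < x" using cInf_lessD[OF ne, of x] by (auto simp: a_def)
      moreover obtain z where "z \<in> K" "x < z" using less_cSupD[OF ne, of x] x by (auto simp: b_def)
      ultimately show "x \<in> K" using inK[of y z x] by auto
    qed
    hence ab: "a < b" using ne by auto
    have "b \<in> C"
    proof (rule ccontr)
      assume "b \<notin> C"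
      hence "b \<in> ?N" using a0 ab by simp
      then obtain e where e: "e > 0" "ball b e \<subseteq> ?N" using N open_contains_ball by blast
      obtain y where y: "y \<in> K" "b - e < y" using less_cSupD[OF ne, of "b - e"] e by (auto simp: b_def)
      have "y \<le> b" unfolding b_def by (rule cSup_upper[OF y(1) True])
      hence "ball b e \<subseteq> K" by (intro maximal[OF e(2) y(1)]) (use y in \<open>auto simp: dist_real_def\<close>)
      thus False using bK e centre_in_ball by blast
    qed
    thus ?thesis using bounded a0 ab aC Ke by blast
  qed
qed

lemma gamma2_right_rate:
  assumes "0 \<le> a" and h: "\<And>n. 0 < h n" "h \<longlonglongrightarrow> 0"
  shows "(\<lambda>n. emeasure gamma2 {a<..<a + h n} / ennreal (h n)) \<longlonglongrightarrow> ennreal (ent (exp (- a)))"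
proof -
  have "((\<lambda>x. (gamma2_prim (a + x) - gamma2_prim a) / x) \<longlongrightarrow> a * exp (- a)) (at 0)"
    using gamma2_prim_deriv[of a] by (simp add: DERIV_def)
  moreover have "filterlim h (at 0) sequentially"
    using h by (auto simp: filterlim_at intro!: always_eventually) (metis less_irrefl)
  ultimately have "(\<lambda>n. (gamma2_prim (a + h n) - gamma2_prim a) / h n) \<longlonglongrightarrow> a * exp (- a)"
    by (rule filterlim_compose)
  hence "(\<lambda>n. ennreal ((gamma2_prim (a + h n) - gamma2_prim a) / h n)) \<longlonglongrightarrow> ennreal (ent (exp (- a)))"
    by (simp add: ent_def mult.commute tendsto_ennrealI)
  moreover have "emeasure gamma2 {a<..<a + h n} / ennreal (h n) = ennreal ((gamma2_prim (a + h n) - gamma2_prim a) / h n)" for n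
  proof -
    have "gamma2_prim a \<le> gamma2_prim (a + h n)"
      by (rule DERIV_nonneg_imp_nondecreasing) (use h(1)[of n] assms(1) gamma2_prim_deriv in \<open>auto intro!: exI[of _ "_ * exp (- _)"]\<close>)
    thus ?thesis using assms(1) h(1)[of n] by (simp add: emeasure_Ioo divide_ennreal)
  qed
  ultimately show ?thesis by simp
qed

lemma gamma2_left_rate:
  assumes "0 < b" and h: "\<And>n. 0 < h n" "h \<longlonglongrightarrow> 0"
  shows "(\<lambda>n. emeasure gamma2 {b - h n<..<b} / ennreal (h n)) \<longlonglongrightarrow> ennreal (ent (exp (- b)))"
proof -
  have "((\<lambda>x. (gamma2_prim (b + x) - gamma2_prim b) / x) \<longlongrightarrow> b * exp (- b)) (at 0)"
    using gamma2_prim_deriv[of b] by (simp add: DERIV_def)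
  moreover have "filterlim (\<lambda>n. - h n) (at 0) sequentially"
    using h(1) tendsto_minus[OF h(2)] by (auto simp: filterlim_at intro!: always_eventually) (metis less_irrefl)
  ultimately have "(\<lambda>n. (gamma2_prim (b + - h n) - gamma2_prim b) / - h n) \<longlonglongrightarrow> b * exp (- b)"
    by (rule filterlim_compose)
  hence "(\<lambda>n. ennreal ((gamma2_prim b - gamma2_prim (b - h n)) / h n)) \<longlonglongrightarrow> ennreal (ent (exp (- b)))"
    by (intro tendsto_ennrealI) (simp add: ent_def mult.commute minus_divide_left)
  moreover have "\<forall>\<^sub>F n in sequentially. ennreal ((gamma2_prim b - gamma2_prim (b - h n)) / h n) = emeasure gamma2 {b - h n<..<b} / ennreal (h n)"
    using order_tendstoD(2)[OF h(2) assms(1)]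
  proof eventually_elim
    case (elim n)
    have "gamma2_prim (b - h n) \<le> gamma2_prim b"
      by (rule DERIV_nonneg_imp_nondecreasing) (use h(1)[of n] elim gamma2_prim_deriv in \<open>auto intro!: exI[of _ "_ * exp (- _)"]\<close>)
    thus ?case using elim h(1)[of n] by (simp add: emeasure_Ioo divide_ennreal)
  qed
  ultimately show ?thesis by (rule Lim_transform_eventually)
qed

text \<open>The boundary of the gap \<open>(a, b)\<close> is \<open>ent (exp (- a)) + ent (exp (- b))\<close>, an endpoint
\<open>0\<close> contributing nothing, and \<open>\<gamma> - \<lambda>\<close> of the gap is
\<open>ent (exp (- a)) - ent (exp (- b))\<close>.\<close>

lemma gap_rate:
  assumes C: "closed C" and K: "K \<in> components ({0<..} - C)"
    and h: "\<And>n. 0 < h n" "h \<longlonglongrightarrow> 0" and k: "-1 \<le> k" "k \<le> 1"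
  shows "0 < measure expo K"
    and "ennreal (gap_bound k (measure expo K) - k * (measure gamma2 K - measure expo K))
       \<le> liminf (\<lambda>n. emeasure gamma2 (K \<inter> thicken (h n) C) / ennreal (h n))"
proof -
  have pos: "0 < expo_prim b - expo_prim a" if "a < b" for a b
    using that by (simp add: expo_prim_def)
  have mono: "gamma2_prim a \<le> gamma2_prim b" if "0 \<le> a" "a \<le> b" for a b
    by (rule DERIV_nonneg_imp_nondecreasing) (use that gamma2_prim_deriv in \<open>auto intro!: exI[of _ "_ * exp (- _)"]\<close>)
  have mK: "0 < measure expo K \<and> ennreal (gap_bound k (measure expo K) - k * (measure gamma2 K - measure expo K))
       \<le> liminf (\<lambda>n. emeasure gamma2 (K \<inter> thicken (h n) C) / ennreal (h n))"
    using C K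
  proof (cases rule: gap_cases)
    case (bounded a b)
    let ?l = "\<lambda>n. emeasure gamma2 {a<..<a + h n} / ennreal (h n)"
    let ?r = "\<lambda>n. emeasure gamma2 {b - h n<..<b} / ennreal (h n)"
    have meas: "measure expo K = exp (- a) - exp (- b)"
      "measure gamma2 K = gamma2_prim b - gamma2_prim a"
      using bounded mono[of a b] pos[of a b] by (auto simp: measure_def emeasure_Ioo) (simp_all add: expo_prim_def)
    have "gap_bound k (measure expo K) \<le> (1 + k) * ent (exp (- a)) + (1 - k) * ent (exp (- b))"
      unfolding meas by (rule gap_bound_interval) (use k bounded in auto)
    hence "gap_bound k (measure expo K) - k * (measure gamma2 K - measure expo K) \<le> ent (exp (- a)) + ent (exp (- b))"
      unfolding meas by (simp add: ent_def gamma2_prim_def algebra_simps)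
    hence "ennreal (gap_bound k (measure expo K) - k * (measure gamma2 K - measure expo K))
      \<le> ennreal (ent (exp (- a)) + ent (exp (- b)))" by (rule ennreal_leI)
    also have "\<dots> = ennreal (ent (exp (- a))) + ennreal (ent (exp (- b)))"
    proof (rule ennreal_plus)
      show "0 \<le> ent (exp (- a))" "0 \<le> ent (exp (- b))"
        using bounded by (simp_all add: ent_nonneg)
    qed
    also have "\<dots> \<le> liminf (\<lambda>n. emeasure gamma2 (K \<inter> thicken (h n) C) / ennreal (h n))"
    proof -
      have lim: "(\<lambda>n. (if a = 0 then 0 else ?l n) + ?r n) \<longlonglongrightarrow> ennreal (ent (exp (- a))) + ennreal (ent (exp (- b)))"
      proof (intro tendsto_add gamma2_left_rate h)
        show "(\<lambda>n. if a = 0 then 0 else ?l n) \<longlonglongrightarrow> ennreal (ent (exp (- a)))"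
          using gamma2_right_rate[OF bounded(1), of h] h by (cases "a = 0") auto
      qed (use bounded in auto)
      have ev: "\<forall>\<^sub>F n in sequentially. h n < (b - a) / 2"
        using order_tendstoD(2)[OF h(2), of "(b - a) / 2"] bounded by simp
      have "\<forall>\<^sub>F n in sequentially. (if a = 0 then 0 else ?l n) + ?r n
           \<le> emeasure gamma2 (K \<inter> thicken (h n) C) / ennreal (h n)"
        using ev
      proof eventually_elim
        case (elim n)
        let ?L = "if a = 0 then {} else {a<..<a + h n}" and ?R = "{b - h n<..<b}"
        have "?L \<union> ?R \<subseteq> {a<..<b}" using elim bounded(2) h(1)[of n] by (auto split: if_splits)
        moreover have "x \<in> thicken (h n) C" if "x \<in> ?L" for x
          unfolding thicken_def using that bounded(3) by (auto intro!: bexI[of _ a] split: if_splits)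
        moreover have "x \<in> thicken (h n) C" if "x \<in> ?R" for x
          unfolding thicken_def using that bounded(4) by (auto intro!: bexI[of _ b])
        ultimately have "?L \<union> ?R \<subseteq> K \<inter> thicken (h n) C" unfolding bounded(5) by blast
        hence "emeasure gamma2 (?L \<union> ?R) \<le> emeasure gamma2 (K \<inter> thicken (h n) C)"
          by (rule emeasure_mono) (use bounded open_thicken[of "h n" C] in auto)
        moreover have "emeasure gamma2 (?L \<union> ?R) = emeasure gamma2 ?L + emeasure gamma2 ?R"
          by (rule plus_emeasure[symmetric]) (use elim in auto)
        ultimately have "(emeasure gamma2 ?L + emeasure gamma2 ?R) / ennreal (h n) \<le> emeasure gamma2 (K \<inter> thicken (h n) C) / ennreal (h n)"
          by (intro divide_right_mono_ennreal) simp
        thus ?case by (cases "a = 0") (simp_all add: add_divide_distrib_ennreal)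
      qed
      hence "liminf (\<lambda>n. (if a = 0 then 0 else ?l n) + ?r n) \<le> liminf (\<lambda>n. emeasure gamma2 (K \<inter> thicken (h n) C) / ennreal (h n))"
        by (rule Liminf_mono)
      thus ?thesis using lim_imp_Liminf[OF _ lim] by simp
    qed
    finally show ?thesis using meas pos[of a b] bounded by (simp add: expo_prim_def)
  next
    case (unbounded a)
    let ?l = "\<lambda>n. emeasure gamma2 {a<..<a + h n} / ennreal (h n)"
    have "0 \<le> - gamma2_prim a" using unbounded by (simp add: gamma2_prim_def mult_nonpos_nonneg)
    hence meas: "measure expo K = exp (- a)" "measure gamma2 K = - gamma2_prim a"
      using unbounded by (auto simp: measure_def emeasure_Ioi expo_prim_def)
    have "gap_bound k (measure expo K - 0) \<le> (1 + k) * ent (exp (- a)) + (1 - k) * ent 0"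
      unfolding meas by (rule gap_bound_interval) (use k unbounded in auto)
    hence "gap_bound k (measure expo K) - k * (measure gamma2 K - measure expo K) \<le> ent (exp (- a))"
      unfolding meas by (simp add: ent_def gamma2_prim_def algebra_simps)
    hence "ennreal (gap_bound k (measure expo K) - k * (measure gamma2 K - measure expo K)) \<le> ennreal (ent (exp (- a)))"
      by (rule ennreal_leI)
    also have "\<dots> \<le> liminf (\<lambda>n. emeasure gamma2 (K \<inter> thicken (h n) C) / ennreal (h n))"
    proof (cases "a = 0")
      case True
      thus ?thesis by simp
    next
      case False
      have lim: "?l \<longlonglongrightarrow> ennreal (ent (exp (- a)))"
        by (rule gamma2_right_rate) (use unbounded h in auto)
      have "?l n \<le> emeasure gamma2 (K \<inter> thicken (h n) C) / ennreal (h n)" for n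
      proof (intro divide_right_mono_ennreal emeasure_mono)
        show "{a<..<a + h n} \<subseteq> K \<inter> thicken (h n) C"
          using unbounded(2,3) False by (auto simp: thicken_def intro!: bexI[of _ a])
      qed (use unbounded open_thicken[of "h n" C] in auto)
      hence "liminf ?l \<le> liminf (\<lambda>n. emeasure gamma2 (K \<inter> thicken (h n) C) / ennreal (h n))"
        by (intro Liminf_mono always_eventually allI)
      thus ?thesis using lim_imp_Liminf[OF _ lim] by simp
    qed
    finally show ?thesis using meas by simp
  qed
  show "0 < measure expo K"
    and "ennreal (gap_bound k (measure expo K) - k * (measure gamma2 K - measure expo K))
       \<le> liminf (\<lambda>n. emeasure gamma2 (K \<inter> thicken (h n) C) / ennreal (h n))"
    using mK by auto
qed

text \<open>The boundary of \<open>C\<close> is at least the sum over its gaps. On each gap it is bounded below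
by a quantity that is additive in the gap, so finitely many gaps can be combined, and continuity of
the measures gives all of them.\<close>

lemma slice_rate_complement:
  assumes C: "closed C" and h: "\<And>n. 0 < h n" "h \<longlonglongrightarrow> 0"
    and k: "-1 \<le> k" "k \<le> 1" and N: "N = {0<..} - C"
  shows "ennreal (gap_bound k (measure expo N) - k * (measure gamma2 N - measure expo N))
       \<le> liminf (\<lambda>n. emeasure gamma2 (thicken (h n) C - C) / ennreal (h n))" (is "_ \<le> ?lim")
proof (cases "N = {}")
  case True
  thus ?thesis by (simp add: gap_bound_def)
next
  case False
  (* The chord of \<open>gap_bound k\<close> up to the total \<open>\<lambda>\<close>-measure of the gaps has slope \<open>g\<close>; so
     \<open>Q\<close> is additive, below the boundary on every gap, and equal to the claimed bound on \<open>N\<close>. *)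
  define g where "g = gap_bound k (measure expo N) / measure expo N"
  define Q where "Q = (\<lambda>X. g * measure expo X - k * (measure gamma2 X - measure expo X))"
  let ?K = "components N"
  have oN: "open N" using C unfolding N by (simp add: open_Diff)
  have oK: "open K" if "K \<in> ?K" for K using open_components[OF oN that] .
  have cK: "countable ?K"
    by (rule countable_disjoint_open_subsets)
      (use oK pairwise_disjoint_components[of N] in \<open>auto simp: pairwise_def disjnt_def\<close>)
  have sK: "K \<in> sets gamma2" "K \<in> sets expo" if "K \<in> ?K" for K using oK[OF that] by auto
  have KN: "K \<subseteq> N" if "K \<in> ?K" for K using in_components_subset[OF that] .
  have Kpos: "0 < measure expo K" if "K \<in> ?K" for K
    by (rule gap_rate(1)[OF C, of _ h k]) (use that h k in \<open>auto simp: N\<close>)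
  have neK: "?K \<noteq> {}" using False Union_components[of N] by auto
  then obtain K0 where K0: "K0 \<in> ?K" by blast
  have Kle: "measure expo K \<le> measure expo N" if "K \<in> ?K" for K
    by (rule expo.finite_measure_mono[OF KN[OF that]]) (use oN in auto)
  have Npos: "0 < measure expo N" using Kpos[OF K0] Kle[OF K0] by simp
  have N1: "measure expo N \<le> 1"
    using expo.finite_measure_mono[of N UNIV] measure_UNIV_1 by simp
  have rate: "ennreal (Q K) \<le> liminf (\<lambda>n. emeasure gamma2 (K \<inter> thicken (h n) C) / ennreal (h n))" if "K \<in> ?K" for K
  proof -
    have "g * measure expo K \<le> gap_bound k (measure expo K)"
      using gap_bound_star[of k "measure expo K" "measure expo N"] k Kle[OF that] Npos N1
      by (simp add: g_def mult.commute)
    hence "ennreal (Q K) \<le> ennreal (gap_bound k (measure expo K) - k * (measure gamma2 K - measure expo K))"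
      by (intro ennreal_leI) (simp add: Q_def)
    also have "\<dots> \<le> liminf (\<lambda>n. emeasure gamma2 (K \<inter> thicken (h n) C) / ennreal (h n))"
      by (rule gap_rate(2)[OF C]) (use that h k in \<open>auto simp: N\<close>)
    finally show ?thesis .
  qed
  have disj: "disjoint_family_on id F" if "F \<subseteq> ?K" for F
    using that pairwise_disjoint_components[of N] by (auto simp: disjoint_family_on_def pairwise_def)
  have fin: "ennreal (Q (\<Union>F)) \<le> ?lim" if F: "finite F" "F \<subseteq> ?K" for F
  proof -
    have "Q (\<Union>F) = (\<Sum>K\<in>F. Q K)"
    proof -
      have "measure expo (\<Union>F) = (\<Sum>K\<in>F. measure expo K)" "measure gamma2 (\<Union>F) = (\<Sum>K\<in>F. measure gamma2 K)"
        using expo.finite_measure_finite_Union[OF F(1) _ disj[OF F(2)]]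
          gamma2.finite_measure_finite_Union[OF F(1) _ disj[OF F(2)]] F(2) sK by auto
      thus ?thesis by (simp add: Q_def sum_subtractf flip: sum_distrib_left)
    qed
    hence "ennreal (Q (\<Union>F)) \<le> (\<Sum>K\<in>F. ennreal (Q K))"
    proof -
      have "ennreal (\<Sum>K\<in>F. Q K) \<le> ennreal (\<Sum>K\<in>F. max 0 (Q K))"
        by (intro ennreal_leI sum_mono) simp
      also have "\<dots> = (\<Sum>K\<in>F. ennreal (max 0 (Q K)))" by (rule sum_ennreal[symmetric]) simp
      also have "\<dots> = (\<Sum>K\<in>F. ennreal (Q K))" by (intro sum.cong refl) (simp add: max_def ennreal_neg)
      finally show ?thesis using \<open>Q (\<Union>F) = (\<Sum>K\<in>F. Q K)\<close> by simp
    qed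
    also have "\<dots> = (\<integral>\<^sup>+K. ennreal (Q K) \<partial>count_space F)"
      by (rule nn_integral_count_space_finite[OF F(1), symmetric])
    also have "\<dots> \<le> (\<integral>\<^sup>+K. liminf (\<lambda>n. emeasure gamma2 (K \<inter> thicken (h n) C) / ennreal (h n)) \<partial>count_space F)"
      by (intro nn_integral_mono rate) (use F in auto)
    also have "\<dots> \<le> liminf (\<lambda>n. \<integral>\<^sup>+K. emeasure gamma2 (K \<inter> thicken (h n) C) / ennreal (h n) \<partial>count_space F)"
      by (rule nn_integral_liminf) simp
    also have "\<dots> \<le> ?lim"
    proof (intro Liminf_mono always_eventually allI)
      fix n
      have "(\<integral>\<^sup>+K. emeasure gamma2 (K \<inter> thicken (h n) C) / ennreal (h n) \<partial>count_space F)
          = (\<integral>\<^sup>+K. emeasure gamma2 (K \<inter> thicken (h n) C) \<partial>count_space F) / ennreal (h n)"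
        by (rule nn_integral_divide) simp
      also have "(\<integral>\<^sup>+K. emeasure gamma2 (K \<inter> thicken (h n) C) \<partial>count_space F)
          = emeasure gamma2 (\<Union>K\<in>F. K \<inter> thicken (h n) C)"
      proof (rule emeasure_UN_countable[symmetric])
        show "disjoint_family_on (\<lambda>K. K \<inter> thicken (h n) C) F"
        proof (unfold disjoint_family_on_def, intro ballI impI)
          fix K K' assume "K \<in> F" "K' \<in> F" "K \<noteq> K'"
          hence "K \<inter> K' = {}" using disj[OF F(2)] by (simp add: disjoint_family_on_def)
          thus "(K \<inter> thicken (h n) C) \<inter> (K' \<inter> thicken (h n) C) = {}" by blast
        qed
        show "K \<inter> thicken (h n) C \<in> sets gamma2" if "K \<in> F" for K
          using that F(2) sK open_thicken[of "h n" C] by auto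
      qed (use F in \<open>auto simp: countable_finite\<close>)
      also have "\<dots> \<le> emeasure gamma2 (thicken (h n) C - C)"
        by (rule emeasure_mono) (use F KN C open_thicken[of "h n" C] in \<open>auto simp: N\<close>)
      finally show "(\<integral>\<^sup>+K. emeasure gamma2 (K \<inter> thicken (h n) C) / ennreal (h n) \<partial>count_space F)
        \<le> emeasure gamma2 (thicken (h n) C - C) / ennreal (h n)"
        by (simp add: divide_right_mono_ennreal)
    qed
    finally show ?thesis .
  qed
  define F where "F = (\<lambda>n::nat. from_nat_into ?K ` {..<n})"
  have F: "finite (F n)" "F n \<subseteq> ?K" for n
    unfolding F_def using from_nat_into[OF neK] by auto
  have inc: "incseq (\<lambda>n. \<Union>(F n))" unfolding F_def incseq_def by fastforce
  have UF: "(\<Union>n. \<Union>(F n)) = N"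
  proof -
    have "(\<Union>n. \<Union>(F n)) = \<Union>(range (from_nat_into ?K))" unfolding F_def by (auto intro: lessI)
    also have "\<dots> = N" using range_from_nat_into[OF neK cK] by simp
    finally show ?thesis .
  qed
  have sF: "\<Union>(F n) \<in> sets borel" for n using F[of n] oK by (intro borel_open open_Union) auto
  have "(\<lambda>n. Q (\<Union>(F n))) \<longlonglongrightarrow> Q N"
    unfolding Q_def UF[symmetric]
    by (intro tendsto_intros expo.finite_Lim_measure_incseq gamma2.finite_Lim_measure_incseq inc) (use sF in auto)
  hence "(\<lambda>n. ennreal (Q (\<Union>(F n)))) \<longlonglongrightarrow> ennreal (Q N)" by (rule tendsto_ennrealI)
  hence "ennreal (Q N) \<le> ?lim"
    by (rule LIMSEQ_le_const2) (use fin F in auto)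
  moreover have "Q N = gap_bound k (measure expo N) - k * (measure gamma2 N - measure expo N)"
    using Npos by (simp add: Q_def g_def)
  ultimately show ?thesis by simp
qed

text \<open>The one-dimensional inequality, with the boundary measure expressed along a sequence
\<open>h n\<close>.\<close>

lemma slice_rate:
  assumes C: "closed C" and h: "\<And>n. 0 < h n" "h \<longlonglongrightarrow> 0"
    and adm: "admissible_slope i m l k" and l: "0 \<le> l" "l \<le> 1"
  shows "ennreal (i + k * (measure gamma2 C - m))
       \<le> liminf (\<lambda>n. emeasure gamma2 (thicken (h n) C - C) / ennreal (h n)) + ennreal \<bar>measure expo C - l\<bar>"
proof -
  define N where "N = {0<..} - C"
  have compl: "measure gamma2 C = 1 - measure gamma2 N \<and> measure expo C = 1 - measure expo N"
  proof -
    have sets: "C \<in> sets borel" "N \<in> sets borel" using C by (auto simp: N_def)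
    have U: "UNIV = {..<0} \<union> ({0} - C) \<union> (C \<union> N)" by (auto simp: N_def)
    have "{..<0::real} \<inter> {0..} = {}" by auto
    hence "{..<0} \<in> null_sets gamma2" "{..<0} \<in> null_sets expo"
      using emeasure_nonneg_part[of "{..<0}"] by (auto simp: null_sets_def)
    moreover have "{0} - C \<in> null_sets gamma2" "{0} - C \<in> null_sets expo"
      using C null_singleton[of 0] by (auto intro: null_sets_subset)
    ultimately have "{..<0} \<union> ({0} - C) \<in> null_sets gamma2" "{..<0} \<union> ({0} - C) \<in> null_sets expo" by auto
    hence "measure gamma2 (C \<union> N \<union> ({..<0} \<union> ({0} - C))) = measure gamma2 (C \<union> N)"
      "measure expo (C \<union> N \<union> ({..<0} \<union> ({0} - C))) = measure expo (C \<union> N)"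
      using sets unfolding measure_def by (subst emeasure_Un_null_set; simp)+
    hence "measure gamma2 UNIV = measure gamma2 (C \<union> N)" "measure expo UNIV = measure expo (C \<union> N)"
      unfolding U by (simp_all add: Un_commute Un_left_commute)
    thus ?thesis using gamma2.finite_measure_Union[of C N] expo.finite_measure_Union[of C N] sets
      by (auto simp: measure_UNIV_1 N_def)
  qed
  have y: "measure expo N \<le> 1" using compl measure_nonneg[of expo C] by linarith
  have eq: "measure gamma2 C = 1 - measure gamma2 N" "measure expo C = 1 - measure expo N"
    using compl by auto
  have "i + k * (measure gamma2 C - m) \<le> (gap_bound k (measure expo N) - k * (measure gamma2 N - measure expo N)) + \<bar>measure expo C - l\<bar>"
    using admissible_profile[OF adm measure_nonneg y l, folded gap_bound_def]
    unfolding eq right_diff_distrib by linarith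
  also have "\<dots> \<le> max 0 (gap_bound k (measure expo N) - k * (measure gamma2 N - measure expo N)) + \<bar>measure expo C - l\<bar>"
    by simp
  finally have "ennreal (i + k * (measure gamma2 C - m)) \<le> ennreal (max 0 (gap_bound k (measure expo N) - k * (measure gamma2 N - measure expo N)) + \<bar>measure expo C - l\<bar>)"
    by (rule ennreal_leI)
  also have "\<dots> = ennreal (gap_bound k (measure expo N) - k * (measure gamma2 N - measure expo N)) + ennreal \<bar>measure expo C - l\<bar>"
    by (subst ennreal_plus) (auto simp: max_def ennreal_neg)
  also have "\<dots> \<le> liminf (\<lambda>n. emeasure gamma2 (thicken (h n) C - C) / ennreal (h n)) + ennreal \<bar>measure expo C - l\<bar>"
    by (intro add_right_mono slice_rate_complement C h) (use adm in \<open>auto simp: admissible_slope_def N_def\<close>)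
  finally show ?thesis .
qed

section \<open>Polar coordinates for the \<open>\<ell>\<^sub>1\<close>-norm\<close>

definition ray_point :: "real \<Rightarrow> real \<Rightarrow> real \<times> real" where
  "ray_point s u = (s * u, s * (1 - u))"

text \<open>The rectangle in polar coordinates that fits into the \<open>\<ell>\<^sub>1\<close>-ball of radius \<open>h\<close>. Below
the diagonal \<open>u = 1/2\<close>, with both radii equal to \<open>s\<close>, replacing \<open>u\<close> by \<open>(1 + h / s) u\<close> moves the
point by \<open>2 h u \<le> h\<close>; the point of the lemma is that a change of radius by less than \<open>h\<close> can be
made at the same time.\<close>

lemma l1_dist_le_half:
  assumes s: "0 < s" "0 \<le> s'" "\<bar>s - s'\<bar> < h"
    and u: "0 < u" "u \<le> 1/2" "0 < u'" "u' \<le> 1/2"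
    and le: "u \<le> (1 + h / s) * u'" "u' \<le> (1 + h / s) * u"
  shows "l1_norm (ray_point s u - ray_point s' u') < h"
proof -
  have h: "0 < h" using s by simp
  (* The distance is \<open>\<bar>X\<bar> + \<bar>(s - s') - X\<bar>\<close>, the largest of \<open>\<bar>s - s'\<bar>\<close>,
     \<open>2 X - (s - s')\<close> and \<open>(s - s') - 2 X\<close>. *)
  define X where "X = s * u - s' * u'"
  have le1: "s * u \<le> (s + h) * u'" "s * u' \<le> (s + h) * u"
    using mult_left_mono[OF le(1), of s] mult_left_mono[OF le(2), of s] s
    by (simp_all add: distrib_right distrib_left flip: mult.assoc)
  have 1: "2 * X - (s - s') < h"
  proof (cases "u' = 1/2")
    case True
    have "2 * X - (s - s') = - (s * (1 - 2 * u))" by (simp add: X_def True algebra_simps)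
    also have "\<dots> \<le> 0" using s u by simp
    finally show ?thesis using h by simp
  next
    case False
    hence "s' * (1 - 2 * u') < (s + h) * (1 - 2 * u')" using s u by (intro mult_strict_right_mono) auto
    moreover have "2 * (s * u) - 2 * (s * u') \<le> 2 * (h * u')" using le1 by (simp add: algebra_simps)
    ultimately show ?thesis unfolding X_def by (simp add: algebra_simps)
  qed
  have 2: "(s - s') - 2 * X < h"
  proof (cases "u' = 1/2")
    case True
    have "(s - s') - 2 * X = s * (1 - 2 * u)" by (simp add: X_def True algebra_simps)
    also have "\<dots> < h"
    proof (cases "u = 1/2")
      case False
      have "s * (1 - 2 * u) = s - 2 * (s * u)" by (simp add: algebra_simps)
      also have "s / 2 \<le> s * u + h * u" using le1(2) True by (simp add: algebra_simps)
      hence "s - 2 * (s * u) \<le> 2 * (h * u)" by simp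
      also have "2 * (h * u) < h" using h u False by simp
      finally show ?thesis .
    next
      case True
      hence "1 - 2 * u = 0" by simp
      thus ?thesis using h by simp
    qed
    finally show ?thesis .
  next
    case False
    hence "(s - h) * (1 - 2 * u') < s' * (1 - 2 * u')" using s u by (intro mult_strict_right_mono) auto
    moreover have "2 * (s * u') - 2 * (s * u) \<le> 2 * (h * u')"
    proof (cases "u \<le> u'")
      case True
      have "h * u \<le> h * u'" using True h by simp
      with le1(2) have "s * u' \<le> s * u + h * u'" unfolding distrib_right by linarith
      thus ?thesis by simp
    next
      case False
      hence "s * u' \<le> s * u" using s by simp
      moreover have "0 \<le> h * u'" using h u by simp
      ultimately show ?thesis by simp
    qed
    ultimately show ?thesis unfolding X_def by (simp add: algebra_simps)
  qed
  have "l1_norm (ray_point s u - ray_point s' u') = \<bar>X\<bar> + \<bar>(s - s') - X\<bar>"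
    by (simp add: l1_norm_def ray_point_def X_def algebra_simps)
  thus ?thesis using 1 2 s by linarith
qed
lemma l1_dist_less:
  assumes s: "0 < s" "0 \<le> s'" "\<bar>s - s'\<bar> < h"
    and u: "0 < u" "u \<le> 1/2 \<and> u' \<le> 1/2 \<and> 0 < u' \<and> u \<le> (1 + h / s) * u' \<and> u' \<le> (1 + h / s) * u
     \<or> 1/2 \<le> u \<and> 1/2 \<le> u' \<and> u < 1 \<and> u' < 1 \<and> 1 - u \<le> (1 + h / s) * (1 - u') \<and> 1 - u' \<le> (1 + h / s) * (1 - u)"
  shows "l1_norm (ray_point s u - ray_point s' u') < h"
  using u(2)
proof
  assume "1/2 \<le> u \<and> 1/2 \<le> u' \<and> u < 1 \<and> u' < 1 \<and> 1 - u \<le> (1 + h / s) * (1 - u') \<and> 1 - u' \<le> (1 + h / s) * (1 - u)"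
  hence "l1_norm (ray_point s (1 - u) - ray_point s' (1 - u')) < h"
    by (intro l1_dist_le_half s) auto
  thus ?thesis by (simp add: ray_point_def l1_norm_def)
qed (use u in \<open>auto intro!: l1_dist_le_half s\<close>)

definition unif :: "real measure" where
  "unif = density lborel (indicator {0<..<1})"

lemma sets_unif [simp, measurable_cong]: "sets unif = sets borel"
  and space_unif [simp]: "space unif = UNIV"
  by (simp_all add: unif_def)

lemma emeasure_unif: "X \<in> sets borel \<Longrightarrow> emeasure unif X = emeasure lborel (X \<inter> {0<..<1})"
  unfolding unif_def by (simp add: emeasure_density indicator_inter_arith[symmetric] Int_commute)

lemma emeasure_unif_UNIV: "emeasure unif UNIV = 1"
  by (simp add: emeasure_unif)

lemma finite_measure_unif: "finite_measure unif"
  by (auto intro!: finite_measureI simp: emeasure_unif_UNIV)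

interpretation unif: finite_measure unif by (rule finite_measure_unif)
interpretation gamma2_unif: pair_sigma_finite gamma2 unif ..

lemma ray_point_measurable [measurable]:
  "(\<lambda>(s, u). ray_point s u) \<in> borel \<Otimes>\<^sub>M borel \<rightarrow>\<^sub>M borel"
proof -
  have "continuous_on UNIV (\<lambda>p. ray_point (fst p) (snd p))"
    unfolding ray_point_def by (intro continuous_intros)
  hence "(\<lambda>p. ray_point (fst p) (snd p)) \<in> borel_measurable borel"
    by (rule borel_measurable_continuous_onI)
  thus ?thesis by (simp add: borel_prod case_prod_unfold)
qed

lemma l1_norm_ray_point: "0 \<le> s \<Longrightarrow> 0 \<le> u \<Longrightarrow> u \<le> 1 \<Longrightarrow> l1_norm (ray_point s u) = s"
  by (simp add: l1_norm_def ray_point_def abs_mult) (simp add: algebra_simps)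

lemma nn_integral_even:
  fixes g :: "real \<Rightarrow> ennreal"
  assumes [measurable]: "g \<in> borel_measurable borel" and even: "\<And>x. g (- x) = g x"
  shows "(\<integral>\<^sup>+x. g x \<partial>lborel) = 2 * (\<integral>\<^sup>+x. g x * indicator {0<..} x \<partial>lborel)"
proof -
  have "(\<integral>\<^sup>+x. g x \<partial>lborel) = (\<integral>\<^sup>+x. g x * indicator {0<..} x + g x * indicator {..<0} x \<partial>lborel)"
  proof (rule nn_integral_cong_AE)
    have "AE x in lborel. x \<noteq> (0::real)" by (rule AE_lborel_singleton)
    thus "AE x in lborel. g x = g x * indicator {0<..} x + g x * indicator {..<0} x"
      by eventually_elim (auto split: split_indicator)
  qed
  also have "\<dots> = (\<integral>\<^sup>+x. g x * indicator {0<..} x \<partial>lborel) + (\<integral>\<^sup>+x. g x * indicator {..<0} x \<partial>lborel)"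
    by (rule nn_integral_add) auto
  also have "(\<integral>\<^sup>+x. g x * indicator {..<0} x \<partial>lborel) = (\<integral>\<^sup>+x. g x * indicator {0<..} x \<partial>lborel)"
    by (subst nn_integral_real_affine[where c = "-1" and t = 0])
      (auto simp: even intro!: nn_integral_cong split: split_indicator)
  finally show ?thesis by (simp add: mult_2)
qed

text \<open>The substitution \<open>(x, y) = (s u, s (1 - u))\<close>, carried out as \<open>y = s - x\<close> for fixed \<open>x\<close>
followed by \<open>x = s u\<close> for fixed \<open>s\<close>.\<close>

lemma nn_integral_polar:
  fixes f :: "real \<times> real \<Rightarrow> ennreal"
  assumes f: "f \<in> borel_measurable borel"
  shows "(\<integral>\<^sup>+x. \<integral>\<^sup>+y. f (x, y) * indicator {0<..} x * indicator {0<..} y \<partial>lborel \<partial>lborel)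
    = (\<integral>\<^sup>+s. ennreal s * indicator {0..} s * (\<integral>\<^sup>+u. f (ray_point s u) * indicator {0<..<1} u \<partial>lborel) \<partial>lborel)"
proof -
  have [measurable]: "f \<in> borel_measurable (borel \<Otimes>\<^sub>M borel)" using f by (simp add: borel_prod)
  have "(\<integral>\<^sup>+x. \<integral>\<^sup>+y. f (x, y) * indicator {0<..} x * indicator {0<..} y \<partial>lborel \<partial>lborel)
      = (\<integral>\<^sup>+x. \<integral>\<^sup>+s. f (x, s - x) * indicator {0<..} x * indicator {0<..} (s - x) \<partial>lborel \<partial>lborel)"
  proof (rule nn_integral_cong)
    fix x :: real
    show "(\<integral>\<^sup>+y. f (x, y) * indicator {0<..} x * indicator {0<..} y \<partial>lborel)
        = (\<integral>\<^sup>+s. f (x, s - x) * indicator {0<..} x * indicator {0<..} (s - x) \<partial>lborel)"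
      by (subst nn_integral_real_affine[where c = 1 and t = "- x"]) auto
  qed
  also have "\<dots> = (\<integral>\<^sup>+s. \<integral>\<^sup>+x. f (x, s - x) * indicator {0<..} x * indicator {0<..} (s - x) \<partial>lborel \<partial>lborel)"
    by (rule lborel_pair.Fubini') measurable
  also have "\<dots> = (\<integral>\<^sup>+s. ennreal s * indicator {0..} s * (\<integral>\<^sup>+u. f (ray_point s u) * indicator {0<..<1} u \<partial>lborel) \<partial>lborel)"
  proof (rule nn_integral_cong)
    fix s :: real
    show "(\<integral>\<^sup>+x. f (x, s - x) * indicator {0<..} x * indicator {0<..} (s - x) \<partial>lborel)
      = ennreal s * indicator {0..} s * (\<integral>\<^sup>+u. f (ray_point s u) * indicator {0<..<1} u \<partial>lborel)"
    proof (cases "0 < s")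
      case True
      have "(\<integral>\<^sup>+x. f (x, s - x) * indicator {0<..} x * indicator {0<..} (s - x) \<partial>lborel)
         = ennreal s * (\<integral>\<^sup>+u. f (s * u, s - s * u) * indicator {0<..} (s * u) * indicator {0<..} (s - s * u) \<partial>lborel)"
        using True by (subst nn_integral_real_affine[where c = s and t = 0]) auto
      also have "(\<integral>\<^sup>+u. f (s * u, s - s * u) * indicator {0<..} (s * u) * indicator {0<..} (s - s * u) \<partial>lborel)
         = (\<integral>\<^sup>+u. f (ray_point s u) * indicator {0<..<1} u \<partial>lborel)"
        using True by (intro nn_integral_cong)
          (auto simp: ray_point_def right_diff_distrib zero_less_mult_iff split: split_indicator)
      finally show ?thesis using True by simp
    next
      case False
      hence "f (x, s - x) * indicator {0<..} x * indicator {0<..} (s - x) = 0" for x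
        by (auto split: split_indicator)
      hence "(\<integral>\<^sup>+x. f (x, s - x) * indicator {0<..} x * indicator {0<..} (s - x) \<partial>lborel) = (\<integral>\<^sup>+x. 0 \<partial>(lborel :: real measure))"
        by (intro nn_integral_cong)
      moreover have "ennreal s * indicator {0..} s = (0 :: ennreal)"
        using False by (auto split: split_indicator)
      ultimately show ?thesis by simp
    qed
  qed
  finally show ?thesis .
qed

lemma sets_sym [simp]: "sets sym_exp_measure = sets borel" and space_sym [simp]: "space sym_exp_measure = UNIV"
  by (simp_all add: sym_exp_measure_def)

text \<open>The restriction to \<open>0 \<le> s\<close> and \<open>0 < u < 1\<close> costs only a null set and keeps
\<open>(s, u)\<close> in the range where these are genuine coordinates.\<close>

definition polar_set :: "(real \<times> real) set \<Rightarrow> (real \<times> real) set" where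
  "polar_set E = {(s, u). 0 \<le> s \<and> 0 < u \<and> u < 1 \<and> ray_point s u \<in> E}"

lemma polar_set_measurable [measurable]: "E \<in> sets borel \<Longrightarrow> polar_set E \<in> sets (borel \<Otimes>\<^sub>M borel)"
proof -
  assume "E \<in> sets borel"
  hence "(\<lambda>(s, u). ray_point s u) -` E \<inter> space (borel \<Otimes>\<^sub>M borel) \<in> sets (borel \<Otimes>\<^sub>M borel)"
    by (rule measurable_sets[OF ray_point_measurable])
  hence "((\<lambda>(s, u). ray_point s u) -` E \<inter> space (borel \<Otimes>\<^sub>M borel)) \<inter> ({0..} \<times> {0<..<1}) \<in> sets (borel \<Otimes>\<^sub>M borel)"
    by (rule sets.Int) (rule pair_measureI; simp)
  also have "((\<lambda>(s, u). ray_point s u) -` E \<inter> space (borel \<Otimes>\<^sub>M borel)) \<inter> ({0..} \<times> {0<..<1}) = polar_set E"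
    by (auto simp: polar_set_def space_pair_measure)
  finally show ?thesis .
qed

text \<open>Each of the four quadrants contributes the same amount, which cancels the factor \<open>1 / 4\<close>
of the density.\<close>

lemma emeasure_sym_polar:
  assumes E: "E \<in> sets borel" "unconditional E"
  shows "emeasure sym_exp_measure E = emeasure (gamma2 \<Otimes>\<^sub>M unif) (polar_set E)"
proof -
  have [measurable]: "E \<in> sets (borel \<Otimes>\<^sub>M borel)" unfolding borel_prod by (rule E)
  let ?d = "\<lambda>x y. ennreal (1 / 4 * exp (- \<bar>x\<bar> - \<bar>y\<bar>)) * indicator E (x, y)"
  have sgn: "(- x, y) \<in> E \<longleftrightarrow> (x, y) \<in> E" "(x, - y) \<in> E \<longleftrightarrow> (x, y) \<in> E" for x y
  proof -
    have u: "(a * x, b * y) \<in> E" if "(x, y) \<in> E" "a \<in> {-1, 1}" "b \<in> {-1, 1}" for a b x y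
      using E(2) that unfolding unconditional_def by blast
    have 1: "(- x, y) \<in> E" "(x, - y) \<in> E" if "(x, y) \<in> E" for x y
      using u[OF that, of "-1" 1] u[OF that, of 1 "-1"] by simp_all
    show "(- x, y) \<in> E \<longleftrightarrow> (x, y) \<in> E" "(x, - y) \<in> E \<longleftrightarrow> (x, y) \<in> E"
      by (metis 1(1) minus_minus, metis 1(2) minus_minus)
  qed
  hence ind: "indicator E (- x, y) = (indicator E (x, y) :: ennreal)"
     "indicator E (x, - y) = (indicator E (x, y) :: ennreal)" for x y
    by (auto simp: indicator_def)
  have "emeasure sym_exp_measure E = (\<integral>\<^sup>+z. (case z of (x, y) \<Rightarrow> ennreal (1 / 4 * exp (- \<bar>x\<bar> - \<bar>y\<bar>))) * indicator E z \<partial>lborel)"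
    unfolding sym_exp_measure_def using E(1)
    by (subst emeasure_density) (auto simp: borel_prod[symmetric] lborel_prod[symmetric])
  also have "\<dots> = (\<integral>\<^sup>+z. (case z of (x, y) \<Rightarrow> ennreal (1 / 4 * exp (- \<bar>x\<bar> - \<bar>y\<bar>))) * indicator E z \<partial>(lborel \<Otimes>\<^sub>M lborel))"
    by (simp add: lborel_prod)
  also have "\<dots> = (\<integral>\<^sup>+x. \<integral>\<^sup>+y. ?d x y \<partial>lborel \<partial>lborel)"
    by (subst lborel.nn_integral_fst[symmetric]) auto
  also have "\<dots> = (\<integral>\<^sup>+x. 2 * (\<integral>\<^sup>+y. ?d x y * indicator {0<..} y \<partial>lborel) \<partial>lborel)"
    by (intro nn_integral_cong nn_integral_even) (auto simp: ind)
  also have "\<dots> = 2 * (\<integral>\<^sup>+x. (\<integral>\<^sup>+y. ?d x y * indicator {0<..} y \<partial>lborel) \<partial>lborel)"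
    by (rule nn_integral_cmult) measurable
  also have "(\<integral>\<^sup>+x. (\<integral>\<^sup>+y. ?d x y * indicator {0<..} y \<partial>lborel) \<partial>lborel)
     = 2 * (\<integral>\<^sup>+x. (\<integral>\<^sup>+y. ?d x y * indicator {0<..} y \<partial>lborel) * indicator {0<..} x \<partial>lborel)"
    by (rule nn_integral_even) (auto simp: ind)
  also have "2 * (2 * (\<integral>\<^sup>+x. (\<integral>\<^sup>+y. ?d x y * indicator {0<..} y \<partial>lborel) * indicator {0<..} x \<partial>lborel))
     = 4 * (\<integral>\<^sup>+x. (\<integral>\<^sup>+y. ?d x y * indicator {0<..} y * indicator {0<..} x \<partial>lborel) \<partial>lborel)"
    by (subst nn_integral_multc[symmetric]) (auto simp flip: mult.assoc)
  also have "\<dots> = (\<integral>\<^sup>+x. \<integral>\<^sup>+y. 4 * (?d x y * indicator {0<..} y * indicator {0<..} x) \<partial>lborel \<partial>lborel)"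
    by (simp add: nn_integral_cmult)
  also have "\<dots> = (\<integral>\<^sup>+x. \<integral>\<^sup>+y. (\<lambda>z. ennreal (exp (- \<bar>fst z\<bar> - \<bar>snd z\<bar>)) * indicator E z) (x, y) * indicator {0<..} x * indicator {0<..} y \<partial>lborel \<partial>lborel)"
  proof (intro nn_integral_cong)
    fix x y :: real
    have "4 * ennreal (1 / 4 * exp (- \<bar>x\<bar> - \<bar>y\<bar>)) = ennreal (exp (- \<bar>x\<bar> - \<bar>y\<bar>))"
      using ennreal_mult[of 4 "1 / 4 * exp (- \<bar>x\<bar> - \<bar>y\<bar>)"] by simp
    thus "4 * (?d x y * indicator {0<..} y * indicator {0<..} x) = (\<lambda>z. ennreal (exp (- \<bar>fst z\<bar> - \<bar>snd z\<bar>)) * indicator E z) (x, y) * indicator {0<..} x * indicator {0<..} y"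
      by (simp only: fst_conv snd_conv mult.assoc[symmetric]) (simp only: mult_ac)
  qed
  also have "\<dots> = (\<integral>\<^sup>+s. ennreal s * indicator {0..} s * (\<integral>\<^sup>+u. (\<lambda>z. ennreal (exp (- \<bar>fst z\<bar> - \<bar>snd z\<bar>)) * indicator E z) (ray_point s u) * indicator {0<..<1} u \<partial>lborel) \<partial>lborel)"
    by (rule nn_integral_polar, unfold borel_prod[symmetric]) measurable
  also have "\<dots> = (\<integral>\<^sup>+s. (ennreal (s * exp (- s)) * indicator {0..} s) * emeasure unif (Pair s -` polar_set E) \<partial>lborel)"
  proof (rule nn_integral_cong)
    fix s :: real
    show "ennreal s * indicator {0..} s * (\<integral>\<^sup>+u. (\<lambda>z. ennreal (exp (- \<bar>fst z\<bar> - \<bar>snd z\<bar>)) * indicator E z) (ray_point s u) * indicator {0<..<1} u \<partial>lborel)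
      = (ennreal (s * exp (- s)) * indicator {0..} s) * emeasure unif (Pair s -` polar_set E)"
    proof (cases "0 \<le> s")
      case True
      have [measurable]: "Pair s -` polar_set E \<in> sets borel" using sets_Pair1[OF polar_set_measurable[OF E(1)]] by simp
      have "(\<integral>\<^sup>+u. (\<lambda>z. ennreal (exp (- \<bar>fst z\<bar> - \<bar>snd z\<bar>)) * indicator E z) (ray_point s u) * indicator {0<..<1} u \<partial>lborel)
        = (\<integral>\<^sup>+u. ennreal (exp (- s)) * indicator (Pair s -` polar_set E \<inter> {0<..<1}) u \<partial>lborel)"
      proof (rule nn_integral_cong)
        fix u :: real
        have "exp (- \<bar>fst (ray_point s u)\<bar> - \<bar>snd (ray_point s u)\<bar>) = exp (- s)" if "0 < u" "u < 1"
          using l1_norm_ray_point[of s u] True that by (simp add: l1_norm_def)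
        thus "(\<lambda>z. ennreal (exp (- \<bar>fst z\<bar> - \<bar>snd z\<bar>)) * indicator E z) (ray_point s u) * indicator {0<..<1} u
          = ennreal (exp (- s)) * indicator (Pair s -` polar_set E \<inter> {0<..<1}) u"
          by (auto simp: polar_set_def split: split_indicator)
      qed
      also have "\<dots> = ennreal (exp (- s)) * emeasure unif (Pair s -` polar_set E)"
        by (subst nn_integral_cmult_indicator) (auto simp: emeasure_unif)
      finally show ?thesis using True by (simp add: ennreal_mult mult.assoc)
    qed simp
  qed
  also have "\<dots> = (\<integral>\<^sup>+s. emeasure unif (Pair s -` polar_set E) \<partial>gamma2)"
    unfolding gamma2_def by (subst nn_integral_density) (use E in \<open>auto intro!: unif.measurable_emeasure_Pair\<close>)
  also have "\<dots> = emeasure (gamma2 \<Otimes>\<^sub>M unif) (polar_set E)"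
    by (rule unif.emeasure_pair_measure_alt[symmetric]) (use E in measurable)
  finally show ?thesis .
qed

section \<open>Growth along and across rays\<close>

lemma emeasure_lborel_affine:
  assumes [measurable]: "S \<in> sets borel" and c: "0 < c"
  shows "emeasure lborel S = ennreal c * emeasure lborel {x. t + c * x \<in> S}"
proof -
  have "(\<lambda>x. t + c * x) -` S \<inter> space borel \<in> sets borel"
    by (rule measurable_sets[OF _ assms(1)]) measurable
  hence [measurable]: "{x. t + c * x \<in> S} \<in> sets borel" by (simp add: vimage_def)
  have "emeasure lborel S = (\<integral>\<^sup>+x. indicator S x \<partial>lborel)" by simp
  also have "\<dots> = ennreal c * (\<integral>\<^sup>+x. indicator S (t + c * x) \<partial>lborel)"
    by (subst nn_integral_real_affine[where c = c and t = t]) (use c in auto)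
  also have "(\<integral>\<^sup>+x. indicator S (t + c * x) \<partial>lborel) = (\<integral>\<^sup>+x. indicator {x. t + c * x \<in> S} x \<partial>lborel)"
    by (intro nn_integral_cong) (auto split: split_indicator)
  also have "\<dots> = emeasure lborel {x. t + c * x \<in> S}" by simp
  finally show ?thesis .
qed

text \<open>If stretching \<open>Y\<close> by the factor \<open>c\<close> from the two ends of \<open>(0, 1)\<close> towards \<open>1/2\<close>
stays on the same side of \<open>1/2\<close> and inside \<open>Z\<close>, then no mass is counted twice.\<close>

lemma unif_dilation:
  assumes [measurable]: "Y \<in> sets borel" "Z \<in> sets borel" and c: "0 < c"
    and left: "\<And>u. u \<in> Y \<Longrightarrow> 0 < u \<Longrightarrow> u < 1/2 \<Longrightarrow> c * u < 1/2 \<and> c * u \<in> Z"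
    and right: "\<And>u. u \<in> Y \<Longrightarrow> 1/2 < u \<Longrightarrow> u < 1 \<Longrightarrow> c * (1 - u) < 1/2 \<and> 1 - c * (1 - u) \<in> Z"
  shows "c * measure unif Y \<le> measure unif Z"
proof -
  let ?L = "{0<..<1/2::real}" and ?R = "{1/2<..<1::real}"
  have split: "emeasure unif X = emeasure lborel (X \<inter> ?L) + emeasure lborel (X \<inter> ?R)" if [measurable]: "X \<in> sets borel" for X
  proof -
    have "emeasure unif X = emeasure lborel (X \<inter> {0<..<1})" by (rule emeasure_unif) fact
    also have "\<dots> = emeasure lborel (((X \<inter> ?L) \<union> (X \<inter> ?R)) \<union> (X \<inter> {1/2}))"
      by (rule arg_cong[where f = "emeasure lborel"]) auto
    also have "\<dots> = emeasure lborel ((X \<inter> ?L) \<union> (X \<inter> ?R))"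
    proof (rule emeasure_Un_null_set)
      show "X \<inter> {1/2} \<in> null_sets lborel"
        by (rule null_sets_subset[OF finite_imp_null_set_lborel[of "{1/2}"]]) simp_all
    qed simp
    also have "\<dots> = emeasure lborel (X \<inter> ?L) + emeasure lborel (X \<inter> ?R)"
      by (rule plus_emeasure[symmetric]) auto
    finally show ?thesis .
  qed
  have vm: "{x. t + c * x \<in> Z \<inter> V} \<in> sets lborel" if "V \<in> sets borel" for t V
  proof -
    have "(\<lambda>x. t + c * x) -` (Z \<inter> V) \<inter> space borel \<in> sets borel"
      by (rule measurable_sets[of _ borel borel]) (use that in auto)
    thus ?thesis by (simp add: vimage_def)
  qed
  have "ennreal c * emeasure unif Y = ennreal c * emeasure lborel (Y \<inter> ?L) + ennreal c * emeasure lborel (Y \<inter> ?R)"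
    by (simp add: split distrib_left)
  also have "\<dots> \<le> ennreal c * emeasure lborel {x. 0 + c * x \<in> Z \<inter> ?L} + ennreal c * emeasure lborel {x. (1 - c) + c * x \<in> Z \<inter> ?R}"
  proof (intro add_mono mult_left_mono emeasure_mono vm)
    show "Y \<inter> ?L \<subseteq> {x. 0 + c * x \<in> Z \<inter> ?L}" using left c by auto
    show "Y \<inter> ?R \<subseteq> {x. (1 - c) + c * x \<in> Z \<inter> ?R}"
    proof
      fix u assume "u \<in> Y \<inter> ?R"
      hence "c * (1 - u) < 1/2" "1 - c * (1 - u) \<in> Z" "0 < c * (1 - u)" using right[of u] c by auto
      hence "1 - c * (1 - u) \<in> Z \<inter> ?R" by auto
      moreover have "(1 - c) + c * u = 1 - c * (1 - u)" by (simp add: algebra_simps)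
      ultimately show "u \<in> {x. (1 - c) + c * x \<in> Z \<inter> ?R}" by (simp only: mem_Collect_eq)
    qed
  qed auto
  also have "\<dots> = emeasure unif Z"
    using emeasure_lborel_affine[of "Z \<inter> ?L" c 0] emeasure_lborel_affine[of "Z \<inter> ?R" c "1 - c"] c
    by (simp add: split)
  finally have "ennreal (c * measure unif Y) \<le> ennreal (measure unif Z)"
    using c by (simp add: unif.emeasure_eq_measure ennreal_mult)
  thus ?thesis by (simp add: ennreal_le_iff)
qed

definition ray_slice :: "(real \<times> real) set \<Rightarrow> real \<Rightarrow> real set" where
  "ray_slice A u = {s. 0 \<le> s \<and> ray_point s u \<in> A}"

text \<open>The part of the enlargement obtained by moving along rays. The growth from \<open>A\<close> to this set and
from this set to the full enlargement are estimated separately, and the two contributions add up.\<close>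

definition radial_thickening :: "real \<Rightarrow> (real \<times> real) set \<Rightarrow> (real \<times> real) set" where
  "radial_thickening h A = {(s, u). 0 \<le> s \<and> 0 < u \<and> u < 1 \<and> s \<in> thicken h (ray_slice A u)}"

lemma continuous_ray_point [continuous_intros]:
  "continuous_on X f \<Longrightarrow> continuous_on X g \<Longrightarrow> continuous_on X (\<lambda>x. ray_point (f x) (g x))"
  unfolding ray_point_def by (intro continuous_intros)

lemma closed_ray_slice: "closed A \<Longrightarrow> closed (ray_slice A u)"
proof -
  assume "closed A"
  hence "closed ({0..} \<inter> (\<lambda>s. ray_point s u) -` A)"
    by (intro continuous_closed_preimage continuous_intros) auto
  also have "{0..} \<inter> (\<lambda>s. ray_point s u) -` A = ray_slice A u" by (auto simp: ray_slice_def)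
  finally show ?thesis .
qed

lemma polar_subset_radial: "0 < h \<Longrightarrow> polar_set A \<subseteq> radial_thickening h A"
  by (force simp: polar_set_def radial_thickening_def thicken_def ray_slice_def)

lemma radial_subset_enlargement: "radial_thickening h A \<subseteq> polar_set (enlargement A h)"
proof
  fix p assume "p \<in> radial_thickening h A"
  then obtain s u s' where p: "p = (s, u)" "0 \<le> s" "0 < u" "u < 1" "0 \<le> s'" "ray_point s' u \<in> A" "\<bar>s - s'\<bar> < h"
    by (auto simp: radial_thickening_def thicken_def ray_slice_def)
  have "l1_norm (ray_point s u - ray_point s' u) = \<bar>s - s'\<bar> * u + \<bar>s - s'\<bar> * (1 - u)"
    using p by (simp add: l1_norm_def ray_point_def abs_mult flip: left_diff_distrib)
  also have "\<dots> = \<bar>s - s'\<bar>" by (simp add: algebra_simps)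
  finally show "p \<in> polar_set (enlargement A h)"
    using p unfolding polar_set_def enlargement_def
    by (auto intro!: bexI[of _ "ray_point s' u"])
qed

text \<open>Up to the restriction of the coordinates this is a countable union of Minkowski sums of a
closed set and compact segments.\<close>

lemma radial_thickening_measurable:
  assumes A: "closed A"
  shows "radial_thickening h A \<in> sets (borel \<Otimes>\<^sub>M borel)"
proof -
  define S where "S = {p. 0 \<le> fst p \<and> ray_point (fst p) (snd p) \<in> A}"
  have "closed (UNIV \<inter> (\<lambda>p. ray_point (fst p) (snd p)) -` A)"
    by (intro continuous_closed_preimage continuous_intros) (use A in auto)
  moreover have "closed (fst -` {0..} :: (real \<times> real) set)"
    by (intro closed_vimage_fst) auto
  ultimately have "closed (fst -` {0..} \<inter> (\<lambda>p. ray_point (fst p) (snd p)) -` A)" by (intro closed_Int) auto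
  also have "fst -` {0..} \<inter> (\<lambda>p. ray_point (fst p) (snd p)) -` A = S" by (auto simp: S_def)
  finally have S: "closed S" .
  (* Strict inequality in the thickening is exhausted by compact intervals of displacements. *)
  define T where "T = (\<lambda>n::nat. {- h + 1 / Suc n..h - 1 / Suc n} \<times> {0::real})"
  have TT: "\<bar>fst y\<bar> < h \<and> snd y = 0" if "y \<in> T n" for y n
  proof -
    have "0 < 1 / real (Suc n)" by simp
    moreover have "- h + 1 / Suc n \<le> fst y" "fst y \<le> h - 1 / Suc n" "snd y = 0"
      using that unfolding T_def by (auto simp del: of_nat_Suc)
    ultimately show ?thesis by linarith
  qed
  have cl: "closed (\<Union>x\<in>S. \<Union>y\<in>T n. {x + y})" for n
    unfolding T_def by (intro closed_compact_sums S compact_Times) auto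
  have "radial_thickening h A = ({0..} \<times> {0<..<1}) \<inter> (\<Union>n. \<Union>x\<in>S. \<Union>y\<in>T n. {x + y})" (is "_ = _ \<inter> ?U")
  proof (intro equalityI subsetI IntI)
    fix p assume p: "p \<in> radial_thickening h A"
    thus "p \<in> {0..} \<times> {0<..<1}" by (auto simp: radial_thickening_def)
    obtain s u s' where p: "p = (s, u)" "(s', u) \<in> S" "\<bar>s - s'\<bar> < h"
      using p by (auto simp: radial_thickening_def thicken_def ray_slice_def S_def)
    obtain n where "1 / Suc n < h - \<bar>s - s'\<bar>" using nat_approx_posE[of "h - \<bar>s - s'\<bar>"] p(3) by auto
    hence "(s - s', 0) \<in> T n" by (auto simp: T_def)
    moreover have "p = (s', u) + (s - s', 0)" using p by simp
    ultimately show "p \<in> ?U" using p(2) by blast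
  next
    fix p assume p: "p \<in> ({0..} \<times> {0<..<1}) \<inter> ?U"
    then obtain n x y where "x \<in> S" "y \<in> T n" "p = x + y" by blast
    moreover note TT[OF \<open>y \<in> T n\<close>]
    moreover obtain s u where su: "p = (s, u)" by (cases p)
    moreover obtain s' u' where x: "x = (s', u')" by (cases x)
    ultimately have "u' = u" "\<bar>s - s'\<bar> < h" "s' \<in> ray_slice A u"
      by (auto simp: ray_slice_def S_def prod_eq_iff)
    thus "p \<in> radial_thickening h A"
      using p su by (auto simp: radial_thickening_def thicken_def)
  qed
  also have "\<dots> \<in> sets (borel \<Otimes>\<^sub>M borel)"
  proof (intro sets.Int sets.countable_UN)
    show "range (\<lambda>n. \<Union>x\<in>S. \<Union>y\<in>T n. {x + y}) \<subseteq> sets (borel \<Otimes>\<^sub>M borel)"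
      unfolding borel_prod by (rule image_subsetI) (rule borel_closed[OF cl])
  qed (rule pair_measureI; simp)
  finally show ?thesis .
qed

lemma open_enlargement: "open (enlargement A h)"
proof -
  have "enlargement A h = (\<Union>y\<in>A. {x. l1_norm (x - y) < h})"
    by (auto simp: enlargement_def)
  moreover have "open {x. l1_norm (x - y) < h}" for y
    unfolding l1_norm_def by (intro open_Collect_less continuous_intros)
  ultimately show ?thesis by (simp only:) (intro open_UN ballI)
qed

text \<open>If the slice of \<open>A\<close> at radius \<open>s\<close> contains the diagonal point, then the complement of the
enlarged slice, stretched towards the diagonal by \<open>1 + h / s\<close>, still misses the slice of the
radial thickening. If it does not, then for small \<open>h\<close> that slice stays away from the diagonal and
can itself be stretched. Either way, to first order, the complement shrinks or the slice grows by the
fraction \<open>h / s\<close>. Closedness of \<open>A\<close> makes the slices of the radial thickenings shrink to that of \<open>A\<close>.\<close>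

lemma transversal_rate:
  fixes h :: "nat \<Rightarrow> real"
  assumes A: "closed A" and s: "0 < s"
    and h: "\<And>n. 0 < h n" "h \<longlonglongrightarrow> 0" "decseq h"
  defines "X \<equiv> Pair s -` polar_set A"
  shows "ennreal (measure unif (if ray_point s (1/2) \<in> A then UNIV - X else X) / s)
    \<le> liminf (\<lambda>n. emeasure unif (Pair s -` (polar_set (enlargement A (h n)) - radial_thickening (h n) A)) / ennreal (h n))"
proof -
  define E where "E = (\<lambda>n. Pair s -` radial_thickening (h n) A)"
  define T where "T = (\<lambda>n. Pair s -` polar_set (enlargement A (h n)))"
  define c where "c = (\<lambda>n. 1 + h n / s)"
  have c: "1 < c n" for n using h(1)[of n] s by (simp add: c_def)
  have sets [measurable]: "E n \<in> sets borel" "T n \<in> sets borel" "X \<in> sets borel" for n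
    using sets_Pair1[OF radial_thickening_measurable[OF A]] sets_Pair1[OF polar_set_measurable[of A]] A
      sets_Pair1[OF polar_set_measurable[OF borel_open[OF open_enlargement]]]
    by (auto simp: E_def T_def X_def)
  have ET: "E n \<subseteq> T n" for n unfolding E_def T_def using radial_subset_enlargement by blast
  have TI: "u \<in> T n" if asm: "u' \<in> E n" "0 < u" "u < 1"
    "u \<le> 1/2 \<and> u' \<le> 1/2 \<and> u \<le> c n * u' \<and> u' \<le> c n * u \<or>
     1/2 \<le> u \<and> 1/2 \<le> u' \<and> 1 - u \<le> c n * (1 - u') \<and> 1 - u' \<le> c n * (1 - u)" for u u' n
  proof -
    obtain s' where s': "0 \<le> s'" "ray_point s' u' \<in> A" "\<bar>s - s'\<bar> < h n" "0 < u'" "u' < 1"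
      using asm(1) by (auto simp: E_def radial_thickening_def thicken_def ray_slice_def)
    have "l1_norm (ray_point s u - ray_point s' u') < h n"
      by (rule l1_dist_less) (use asm s s' in \<open>auto simp: c_def\<close>)
    thus ?thesis using s s' asm by (auto simp: T_def polar_set_def enlargement_def)
  qed
  have lim: "(\<lambda>n. measure unif (E n)) \<longlonglongrightarrow> measure unif X"
  proof -
    have "X = (\<Inter>n. E n)"
    proof (intro equalityI subsetI)
      fix u assume "u \<in> X"
      thus "u \<in> (\<Inter>n. E n)" using polar_subset_radial[OF h(1)] by (auto simp: X_def E_def)
    next
      fix u assume "u \<in> (\<Inter>n. E n)"
      hence u: "0 < u" "u < 1" "\<And>n. s \<in> thicken (h n) (ray_slice A u)"
        by (auto simp: E_def radial_thickening_def)
      have "s \<in> closure (ray_slice A u)"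
        unfolding closure_approachable
      proof (intro allI impI)
        fix e :: real assume "0 < e"
        hence "\<forall>\<^sub>F n in sequentially. h n < e" by (rule order_tendstoD(2)[OF h(2)])
        then obtain n where "h n < e" using eventually_happens[of _ sequentially] by auto
        thus "\<exists>y\<in>ray_slice A u. dist y s < e" using u(3)[of n]
          by (auto simp: thicken_def dist_real_def abs_minus_commute intro: less_trans)
      qed
      hence "s \<in> ray_slice A u" using closed_ray_slice[OF A] by simp
      thus "u \<in> X" using u by (auto simp: X_def polar_set_def ray_slice_def)
    qed
    moreover have "decseq E"
      unfolding decseq_def
    proof (intro allI impI subsetI)
      fix m n u assume "m \<le> n" "u \<in> E n"
      thus "u \<in> E m" using decseqD[OF h(3), of m n]
        by (force simp: E_def radial_thickening_def thicken_def)
    qed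
    moreover have "range E \<subseteq> sets unif" using sets(1) by auto
    ultimately show ?thesis using unif.finite_Lim_measure_decseq[of E] by simp
  qed
  have diff: "emeasure unif (T n - E n) = ennreal (measure unif (T n) - measure unif (E n))" for n
    using ET[of n] by (simp add: unif.emeasure_eq_measure unif.finite_measure_Diff)
  have unif_total: "measure unif UNIV = 1" by (simp add: measure_def emeasure_unif_UNIV)
  have "\<exists>d. (d \<longlonglongrightarrow> measure unif (if ray_point s (1/2) \<in> A then UNIV - X else X) / s) \<and>
     (\<forall>\<^sub>F n in sequentially. d n * h n \<le> measure unif (T n) - measure unif (E n))"
  proof (cases "ray_point s (1/2) \<in> A")
    case True
    have half: "1/2 \<in> E n" for n
      using True s h(1)[of n] by (auto simp: E_def radial_thickening_def thicken_def ray_slice_def intro!: exI[of _ s])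
    define d where "d = (\<lambda>n. (1 - measure unif (E n)) / (s + h n))"
    have "d \<longlonglongrightarrow> (1 - measure unif X) / (s + 0)"
      unfolding d_def by (intro tendsto_intros lim h) (use s in auto)
    moreover have "d n * h n \<le> measure unif (T n) - measure unif (E n)" for n
    proof -
      (* A point within a factor \<open>c n\<close> of the diagonal is enlarged from the diagonal point itself,
         so a point outside the enlargement cannot cross the diagonal when it is stretched. *)
      have left: "c n * u < 1/2 \<and> c n * u \<notin> E n" if "u \<notin> T n" "0 < u" "u < 1/2" for u
      proof (rule conjI; rule ccontr)
        assume "\<not> c n * u < 1/2"
        hence "u \<in> T n" by (intro TI[of "1/2"] half) (use that c[of n] in auto)
        thus False using that by simp
      next
        assume a: "\<not> c n * u \<notin> E n"
        have le: "u \<le> c n * u" "u \<le> c n * (c n * u)"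
          using mult_right_mono[of 1 "c n" u] mult_mono[of 1 "c n" u "c n * u"] that c[of n] by auto
        show False
        proof (cases "c n * u \<le> 1/2")
          case True
          have "u \<in> T n"
            by (rule TI[of "c n * u"]) (use a True that le in auto)
          thus False using that by simp
        next
          case False
          hence "u \<in> T n" by (intro TI[of "1/2"] half) (use that c[of n] in auto)
          thus False using that by simp
        qed
      qed
      have right: "c n * (1 - u) < 1/2 \<and> 1 - c n * (1 - u) \<notin> E n" if "u \<notin> T n" "1/2 < u" "u < 1" for u
      proof (rule conjI; rule ccontr)
        assume "\<not> c n * (1 - u) < 1/2"
        hence "u \<in> T n" by (intro TI[of "1/2"] half) (use that c[of n] in auto)
        thus False using that by simp
      next
        assume a: "\<not> 1 - c n * (1 - u) \<notin> E n"
        have le: "1 - u \<le> c n * (1 - u)" "1 - u \<le> c n * (c n * (1 - u))"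
          using mult_right_mono[of 1 "c n" "1 - u"] mult_mono[of 1 "c n" "1 - u" "c n * (1 - u)"] that c[of n] by auto
        show False
        proof (cases "c n * (1 - u) \<le> 1/2")
          case True
          have "u \<in> T n"
            by (rule TI[of "1 - c n * (1 - u)"]) (use a True that le in auto)
          thus False using that by simp
        next
          case False
          hence "u \<in> T n" by (intro TI[of "1/2"] half) (use that c[of n] in auto)
          thus False using that by simp
        qed
      qed
      have "c n * measure unif (UNIV - T n) \<le> measure unif (UNIV - E n)"
        by (rule unif_dilation) (use c[of n] left right in auto)
      hence "c n * (1 - measure unif (T n)) \<le> 1 - measure unif (E n)"
        using unif.finite_measure_compl[of "T n"] unif.finite_measure_compl[of "E n"] by (simp add: unif_total)
      hence "(s + h n) * (1 - measure unif (T n)) \<le> s * (1 - measure unif (E n))"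
        using s by (simp add: c_def field_simps)
      thus ?thesis using s h(1)[of n] by (simp add: d_def field_simps)
    qed
    ultimately show ?thesis using True unif.finite_measure_compl[of X] by (intro exI[of _ d]) (auto simp: unif_total)
  next
    case False
    define d where "d = (\<lambda>n. measure unif (E n) / s)"
    have "d \<longlonglongrightarrow> measure unif X / s" unfolding d_def by (intro tendsto_intros lim) (use s in auto)
    moreover have "\<forall>\<^sub>F n in sequentially. d n * h n \<le> measure unif (T n) - measure unif (E n)"
    proof -
      obtain e where e: "0 < e" "e < 1/2" "\<And>s' u. \<bar>s' - s\<bar> < e \<Longrightarrow> \<bar>u - 1/2\<bar> < e \<Longrightarrow> ray_point s' u \<notin> A"
      proof -
        have "open (UNIV \<inter> (\<lambda>p. ray_point (fst p) (snd p)) -` (- A))"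
          by (intro continuous_open_preimage continuous_intros) (use A in auto)
        moreover have "(s, 1/2) \<in> UNIV \<inter> (\<lambda>p. ray_point (fst p) (snd p)) -` (- A)"
          using False by simp
        ultimately obtain r where r: "0 < r"
          "ball (s, 1/2) r \<subseteq> UNIV \<inter> (\<lambda>p. ray_point (fst p) (snd p)) -` (- A)"
          using open_contains_ball by blast
        have "ray_point s' u \<notin> A" if "\<bar>s' - s\<bar> < min (r / 2) (1/4)" "\<bar>u - 1/2\<bar> < min (r / 2) (1/4)" for s' u
        proof -
          have "dist (s, 1/2) (s', u) \<le> \<bar>s' - s\<bar> + \<bar>u - 1/2\<bar>"
            using sqrt_sum_squares_le_sum_abs[of "s - s'" "u - 1/2"]
            by (simp add: dist_Pair_Pair dist_real_def abs_minus_commute)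
          also have "\<dots> < r" using that by linarith
          finally have "(s', u) \<in> ball (s, 1/2) r" by simp
          thus ?thesis using r(2) by auto
        qed
        thus ?thesis using r(1) by (intro that[of "min (r / 2) (1/4)"]) auto
      qed
      have "c \<longlonglongrightarrow> 1 + 0 / s" unfolding c_def by (intro tendsto_intros h) (use s in auto)
      hence "\<forall>\<^sub>F n in sequentially. c n < (1/2) / (1/2 - e)"
        by (rule order_tendstoD) (use e in \<open>simp add: field_simps\<close>)
      moreover have "\<forall>\<^sub>F n in sequentially. h n < e" by (rule order_tendstoD(2)[OF h(2)]) fact
      ultimately show ?thesis
      proof eventually_elim
        case (elim n)
        have far: "e \<le> \<bar>u - 1/2\<bar>" if "u \<in> E n" for u
        proof (rule ccontr)
          assume "\<not> e \<le> \<bar>u - 1/2\<bar>"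
          moreover obtain s' where "ray_point s' u \<in> A" "\<bar>s - s'\<bar> < h n"
            using \<open>u \<in> E n\<close> by (auto simp: E_def radial_thickening_def thicken_def ray_slice_def)
          ultimately show False using e(3)[of s' u] elim(2) by auto
        qed
        have cn: "c n * v < 1/2" if "v \<le> 1/2 - e" for v
        proof -
          have "c n * v \<le> c n * (1/2 - e)" using that c[of n] by (intro mult_left_mono) auto
          also have "\<dots> < 1/2" using elim(1) e by (simp add: field_simps)
          finally show ?thesis .
        qed
        have "c n * measure unif (E n) \<le> measure unif (T n)"
        proof (rule unif_dilation)
          fix u assume u: "u \<in> E n" "0 < u" "u < 1/2"
          have le: "u \<le> c n * u" "u \<le> c n * (c n * u)"
            using mult_right_mono[of 1 "c n" u] mult_mono[of 1 "c n" u "c n * u"] u c[of n] by auto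
          have 1: "c n * u < 1/2" using cn[of u] far[OF u(1)] u by auto
          moreover have "c n * u \<in> T n"
          proof (rule TI[OF u(1)])
            show "0 < c n * u" using u le by linarith
            show "c n * u < 1" using 1 by linarith
          qed (intro disjI1 conjI; use u le 1 in linarith)
          ultimately show "c n * u < 1/2 \<and> c n * u \<in> T n" ..
        next
          fix u assume u: "u \<in> E n" "1/2 < u" "u < 1"
          have le: "1 - u \<le> c n * (1 - u)" "1 - u \<le> c n * (c n * (1 - u))"
            using mult_right_mono[of 1 "c n" "1 - u"] mult_mono[of 1 "c n" "1 - u" "c n * (1 - u)"] u c[of n] by auto
          have 1: "c n * (1 - u) < 1/2" using cn[of "1 - u"] far[OF u(1)] u by auto
          moreover have "1 - c n * (1 - u) \<in> T n"
          proof (rule TI[OF u(1)])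
            show "0 < 1 - c n * (1 - u)" using 1 by linarith
            show "1 - c n * (1 - u) < 1" using u le by linarith
          qed (intro disjI2 conjI; use u le 1 in \<open>simp add: algebra_simps\<close>)
          ultimately show "c n * (1 - u) < 1/2 \<and> 1 - c n * (1 - u) \<in> T n" ..
        qed (use c[of n] in auto)
        thus ?case using s by (simp add: d_def c_def field_simps)
      qed
    qed
    ultimately show ?thesis using False by auto
  qed
  then obtain d where d: "d \<longlonglongrightarrow> measure unif (if ray_point s (1/2) \<in> A then UNIV - X else X) / s"
    "\<forall>\<^sub>F n in sequentially. d n * h n \<le> measure unif (T n) - measure unif (E n)" by blast
  have "ennreal (measure unif (if ray_point s (1/2) \<in> A then UNIV - X else X) / s) = liminf (\<lambda>n. ennreal (d n))"
    using lim_imp_Liminf[OF _ tendsto_ennrealI[OF d(1)]] by simp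
  also have "\<dots> \<le> liminf (\<lambda>n. emeasure unif (T n - E n) / ennreal (h n))"
  proof (rule Liminf_mono)
    show "\<forall>\<^sub>F n in sequentially. ennreal (d n) \<le> emeasure unif (T n - E n) / ennreal (h n)"
      using d(2)
    proof eventually_elim
      case (elim n)
      have "0 \<le> measure unif (T n) - measure unif (E n)"
        using unif.finite_measure_mono[OF ET[of n]] by simp
      hence "emeasure unif (T n - E n) / ennreal (h n) = ennreal ((measure unif (T n) - measure unif (E n)) / h n)"
        unfolding diff by (rule divide_ennreal) (use h in auto)
      moreover have "d n \<le> (measure unif (T n) - measure unif (E n)) / h n"
        using elim h(1)[of n] by (simp add: field_simps)
      ultimately show ?case by (simp add: ennreal_leI)
    qed
  qed
  finally show ?thesis by (simp add: E_def T_def vimage_Diff)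
qed

section \<open>Integration over rays and radii\<close>

interpretation expo_unif: pair_sigma_finite expo unif ..

lemma sets_pairs: "sets (gamma2 \<Otimes>\<^sub>M unif) = sets (borel \<Otimes>\<^sub>M borel)" "sets (expo \<Otimes>\<^sub>M unif) = sets (borel \<Otimes>\<^sub>M borel)"
  by (intro sets_pair_measure_cong; simp)+

text \<open>Fatou's lemma for a two-point space.\<close>

lemma liminf_add_ennreal:
  fixes f g :: "nat \<Rightarrow> ennreal"
  shows "liminf f + liminf g \<le> liminf (\<lambda>n. f n + g n)"
proof -
  have "(\<integral>\<^sup>+b. liminf (\<lambda>n. if b then f n else g n) \<partial>count_space UNIV)
    \<le> liminf (\<lambda>n. \<integral>\<^sup>+b. (if b then f n else g n) \<partial>count_space (UNIV :: bool set))"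
    by (rule nn_integral_liminf) simp
  thus ?thesis by (simp add: nn_integral_count_space_finite UNIV_bool add.commute)
qed

lemma AE_unif: "AE u in unif. 0 < u \<and> u < 1"
  unfolding unif_def by (subst AE_density) (auto split: split_indicator)

text \<open>The rate \<open>1 / s\<close> of the transversal motion turns \<open>\<gamma>\<close> into \<open>\<lambda>\<close>.\<close>

lemma nn_integral_gamma2_expo: "f \<in> borel_measurable borel \<Longrightarrow> (\<integral>\<^sup>+s. ennreal (1 / s) * f s \<partial>gamma2) = (\<integral>\<^sup>+s. f s \<partial>expo)"
  unfolding gamma2_def expo_def
proof -
  assume [measurable]: "f \<in> borel_measurable borel"
  have "(\<integral>\<^sup>+s. ennreal (1 / s) * f s \<partial>density lborel (\<lambda>s. ennreal (s * exp (- s)) * indicator {0..} s))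
    = (\<integral>\<^sup>+s. (ennreal (s * exp (- s)) * indicator {0..} s) * (ennreal (1 / s) * f s) \<partial>lborel)"
    by (rule nn_integral_density) auto
  also have "\<dots> = (\<integral>\<^sup>+s. (ennreal (exp (- s)) * indicator {0..} s) * f s \<partial>lborel)"
  proof (rule nn_integral_cong_AE)
    have "AE s in lborel. s \<noteq> (0::real)" by (rule AE_lborel_singleton)
    thus "AE s in lborel. (ennreal (s * exp (- s)) * indicator {0..} s) * (ennreal (1 / s) * f s) = (ennreal (exp (- s)) * indicator {0..} s) * f s"
    proof eventually_elim
      case (elim s)
      have "ennreal (s * exp (- s)) * ennreal (1 / s) = ennreal (exp (- s))" if "0 \<le> s"
        using that elim by (subst ennreal_mult[symmetric]) auto
      thus ?case by (auto simp: mult.assoc[symmetric] split: split_indicator)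
    qed
  qed
  also have "\<dots> = (\<integral>\<^sup>+s. f s \<partial>density lborel (\<lambda>s. ennreal (exp (- s)) * indicator {0..} s))"
    by (rule nn_integral_density[symmetric]) auto
  finally show "(\<integral>\<^sup>+s. ennreal (1 / s) * f s \<partial>density lborel (\<lambda>s. ennreal (s * exp (- s)) * indicator {0..} s))
    = (\<integral>\<^sup>+s. f s \<partial>density lborel (\<lambda>s. ennreal (exp (- s)) * indicator {0..} s))" .
qed

lemma radial_slice:
  assumes A: "closed A" and u: "0 < u" "u < 1"
  shows "emeasure gamma2 ((\<lambda>s. (s, u)) -` (radial_thickening h A - polar_set A))
    = emeasure gamma2 (thicken h (ray_slice A u) - ray_slice A u)"
proof -
  have "thicken h (ray_slice A u) - ray_slice A u \<in> sets borel"
    using open_thicken[of h "ray_slice A u"] closed_ray_slice[OF A, of u] by auto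
  hence "emeasure gamma2 (thicken h (ray_slice A u) - ray_slice A u)
     = emeasure gamma2 ((thicken h (ray_slice A u) - ray_slice A u) \<inter> {0..})"
    by (rule emeasure_nonneg_part)
  also have "(thicken h (ray_slice A u) - ray_slice A u) \<inter> {0..} = (\<lambda>s. (s, u)) -` (radial_thickening h A - polar_set A)"
    using u by (auto simp: radial_thickening_def polar_set_def ray_slice_def)
  finally show ?thesis by simp
qed

lemma radial_part:
  fixes h :: "nat \<Rightarrow> real"
  assumes A: "closed A"
  defines "S \<equiv> \<lambda>n u. emeasure gamma2 ((\<lambda>s. (s, u)) -` (radial_thickening (h n) A - polar_set A))"
  shows "S n \<in> borel_measurable unif"
    and "(\<integral>\<^sup>+u. liminf (\<lambda>n. S n u / ennreal (h n)) \<partial>unif)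
    \<le> liminf (\<lambda>n. emeasure (gamma2 \<Otimes>\<^sub>M unif) (radial_thickening (h n) A - polar_set A) / ennreal (h n))"
proof -
  have "A \<in> sets borel" using A by auto
  have R: "radial_thickening (h n) A - polar_set A \<in> sets (borel \<Otimes>\<^sub>M borel)" for n
    by (rule sets.Diff[OF radial_thickening_measurable[OF A] polar_set_measurable]) fact
  have Sm [measurable]: "S n \<in> borel_measurable unif" for n
    unfolding S_def by (rule gamma2_unif.measurable_emeasure_Pair2) (unfold sets_pairs, rule R)
  show "S n \<in> borel_measurable unif" by (rule Sm)
  have "(\<integral>\<^sup>+u. liminf (\<lambda>n. S n u / ennreal (h n)) \<partial>unif) \<le> liminf (\<lambda>n. \<integral>\<^sup>+u. S n u / ennreal (h n) \<partial>unif)"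
    by (rule nn_integral_liminf) measurable
  also have "(\<lambda>n. \<integral>\<^sup>+u. S n u / ennreal (h n) \<partial>unif) = (\<lambda>n. emeasure (gamma2 \<Otimes>\<^sub>M unif) (radial_thickening (h n) A - polar_set A) / ennreal (h n))"
  proof
    fix n
    have "(\<integral>\<^sup>+u. S n u / ennreal (h n) \<partial>unif) = (\<integral>\<^sup>+u. S n u \<partial>unif) / ennreal (h n)"
      by (rule nn_integral_divide) (rule Sm)
    also have "(\<integral>\<^sup>+u. S n u \<partial>unif) = emeasure (gamma2 \<Otimes>\<^sub>M unif) (radial_thickening (h n) A - polar_set A)"
      unfolding S_def by (rule gamma2_unif.emeasure_pair_measure_alt2[symmetric]) (unfold sets_pairs, rule R)
    finally show "(\<integral>\<^sup>+u. S n u / ennreal (h n) \<partial>unif) = emeasure (gamma2 \<Otimes>\<^sub>M unif) (radial_thickening (h n) A - polar_set A) / ennreal (h n)" .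
  qed
  finally show "(\<integral>\<^sup>+u. liminf (\<lambda>n. S n u / ennreal (h n)) \<partial>unif)
    \<le> liminf (\<lambda>n. emeasure (gamma2 \<Otimes>\<^sub>M unif) (radial_thickening (h n) A - polar_set A) / ennreal (h n))" .
qed

text \<open>The slices at fixed radius disagree here with their value on the diagonal \<open>u = 1/2\<close>. The
disagreement is recorded as a plane set in order to integrate it first over \<open>u\<close> or first over
\<open>s\<close>.\<close>

definition diagonal_defect :: "(real \<times> real) set \<Rightarrow> (real \<times> real) set" where
  "diagonal_defect A = (polar_set A - ray_slice A (1/2) \<times> UNIV) \<union> (ray_slice A (1/2) \<times> UNIV - polar_set A)"

lemma diagonal_defect_measurable:
  assumes "closed A" shows "diagonal_defect A \<in> sets (borel \<Otimes>\<^sub>M borel)"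
proof -
  have "ray_slice A (1/2) \<times> UNIV \<in> sets (borel \<Otimes>\<^sub>M borel)"
    using closed_ray_slice[OF assms] by (intro pair_measureI) auto
  thus ?thesis unfolding diagonal_defect_def
    by (intro sets.Un sets.Diff polar_set_measurable borel_closed assms)
qed

lemma diagonal_defect_slice:
  assumes A: "closed A" and u: "0 < u" "u < 1"
  shows "ennreal \<bar>measure expo (ray_slice A u) - measure expo (ray_slice A (1/2))\<bar>
    \<le> emeasure expo ((\<lambda>s. (s, u)) -` diagonal_defect A)"
proof -
  let ?C = "ray_slice A u" and ?B = "ray_slice A (1/2)"
  have cs: "?C \<in> sets borel" "?B \<in> sets borel" using closed_ray_slice[OF A] by auto
  have "(\<lambda>s. (s, u)) -` diagonal_defect A = (?C - ?B) \<union> (?B - ?C)"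
    using u by (auto simp: diagonal_defect_def polar_set_def ray_slice_def)
  moreover have "\<bar>measure expo ?C - measure expo ?B\<bar> \<le> measure expo ((?C - ?B) \<union> (?B - ?C))"
  proof -
    have "measure expo ?C \<le> measure expo (?B \<union> ((?C - ?B) \<union> (?B - ?C)))"
      "measure expo ?B \<le> measure expo (?C \<union> ((?C - ?B) \<union> (?B - ?C)))"
      by (intro expo.finite_measure_mono; use cs in auto)+
    moreover have "measure expo (?B \<union> ((?C - ?B) \<union> (?B - ?C))) \<le> measure expo ?B + measure expo ((?C - ?B) \<union> (?B - ?C))"
      "measure expo (?C \<union> ((?C - ?B) \<union> (?B - ?C))) \<le> measure expo ?C + measure expo ((?C - ?B) \<union> (?B - ?C))"
      by (intro measure_subadditive; use cs in \<open>auto simp: expo.emeasure_eq_measure\<close>)+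
    ultimately show ?thesis by linarith
  qed
  ultimately show ?thesis by (simp add: expo.emeasure_eq_measure ennreal_leI)
qed

text \<open>By Tonelli's theorem the defect may be integrated first over \<open>u\<close>. At each radius \<open>s\<close> the
result, divided by \<open>s\<close>, is a lower bound for the growth rate across rays, and Fatou's lemma applies.\<close>

lemma transversal_part:
  assumes A: "closed A" and h: "\<And>n. 0 < h n" "h \<longlonglongrightarrow> 0" "decseq h"
  shows "(\<integral>\<^sup>+u. emeasure expo ((\<lambda>s. (s, u)) -` diagonal_defect A) \<partial>unif)
    \<le> liminf (\<lambda>n. emeasure (gamma2 \<Otimes>\<^sub>M unif) (polar_set (enlargement A (h n)) - radial_thickening (h n) A) / ennreal (h n))"
proof -
  have Ab [measurable]: "A \<in> sets borel" using A by auto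
  let ?D = "\<lambda>n. polar_set (enlargement A (h n)) - radial_thickening (h n) A"
  have D: "?D n \<in> sets (borel \<Otimes>\<^sub>M borel)" for n
    by (rule sets.Diff[OF polar_set_measurable[OF borel_open[OF open_enlargement]] radial_thickening_measurable[OF A]])
  let ?Y = "diagonal_defect A"
  have Y: "?Y \<in> sets (borel \<Otimes>\<^sub>M borel)" by (rule diagonal_defect_measurable[OF A])
  let ?T = "\<lambda>n s. emeasure unif (Pair s -` ?D n)"
  have Tm [measurable]: "?T n \<in> borel_measurable gamma2" for n
    by (rule unif.measurable_emeasure_Pair) (unfold sets_pairs, rule D)
  have Ym [measurable]: "(\<lambda>s. emeasure unif (Pair s -` ?Y)) \<in> borel_measurable borel"
  proof -
    have "(\<lambda>s. emeasure unif (Pair s -` ?Y)) \<in> borel_measurable expo"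
      by (rule unif.measurable_emeasure_Pair) (unfold sets_pairs, rule Y)
    thus ?thesis by simp
  qed
  have "(\<integral>\<^sup>+u. emeasure expo ((\<lambda>s. (s, u)) -` ?Y) \<partial>unif) = emeasure (expo \<Otimes>\<^sub>M unif) ?Y"
    by (rule expo_unif.emeasure_pair_measure_alt2[symmetric]) (unfold sets_pairs, rule Y)
  also have "\<dots> = (\<integral>\<^sup>+s. emeasure unif (Pair s -` ?Y) \<partial>expo)"
    by (rule unif.emeasure_pair_measure_alt) (unfold sets_pairs, rule Y)
  also have "\<dots> = (\<integral>\<^sup>+s. ennreal (1 / s) * emeasure unif (Pair s -` ?Y) \<partial>gamma2)"
    by (rule nn_integral_gamma2_expo[symmetric]) measurable
  also have "\<dots> \<le> (\<integral>\<^sup>+s. liminf (\<lambda>n. ?T n s / ennreal (h n)) \<partial>gamma2)"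
  proof (rule nn_integral_mono_AE)
    have "AE s in gamma2. 0 < s"
    proof -
      have "AE s in lborel. s \<noteq> (0::real)" by (rule AE_lborel_singleton)
      thus ?thesis unfolding gamma2_def
        by (subst AE_density) (auto elim!: eventually_mono split: split_indicator)
    qed
    thus "AE s in gamma2. ennreal (1 / s) * emeasure unif (Pair s -` ?Y) \<le> liminf (\<lambda>n. ?T n s / ennreal (h n))"
    proof eventually_elim
      case (elim s)
      let ?X = "Pair s -` polar_set A"
      let ?Z = "if ray_point s (1/2) \<in> A then UNIV - ?X else ?X"
      have "Pair s -` ?Y = ?Z"
        using elim by (auto simp: diagonal_defect_def polar_set_def ray_slice_def)
      hence "ennreal (1 / s) * emeasure unif (Pair s -` ?Y) = ennreal (measure unif ?Z / s)"
        using elim by (simp add: unif.emeasure_eq_measure ennreal_mult[symmetric])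
      also have "\<dots> \<le> liminf (\<lambda>n. ?T n s / ennreal (h n))"
        by (rule transversal_rate[OF A elim h])
      finally show ?case .
    qed
  qed
  also have "\<dots> \<le> liminf (\<lambda>n. \<integral>\<^sup>+s. ?T n s / ennreal (h n) \<partial>gamma2)"
    by (rule nn_integral_liminf) measurable
  also have "(\<lambda>n. \<integral>\<^sup>+s. ?T n s / ennreal (h n) \<partial>gamma2) = (\<lambda>n. emeasure (gamma2 \<Otimes>\<^sub>M unif) (?D n) / ennreal (h n))"
  proof
    fix n
    have "(\<integral>\<^sup>+s. ?T n s / ennreal (h n) \<partial>gamma2) = (\<integral>\<^sup>+s. ?T n s \<partial>gamma2) / ennreal (h n)"
      by (rule nn_integral_divide) (rule Tm)
    also have "(\<integral>\<^sup>+s. ?T n s \<partial>gamma2) = emeasure (gamma2 \<Otimes>\<^sub>M unif) (?D n)"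
      by (rule unif.emeasure_pair_measure_alt[symmetric]) (unfold sets_pairs, rule D)
    finally show "(\<integral>\<^sup>+s. ?T n s / ennreal (h n) \<partial>gamma2) = emeasure (gamma2 \<Otimes>\<^sub>M unif) (?D n) / ennreal (h n)" .
  qed
  finally show ?thesis .
qed

lemma unconditional_enlargement:
  assumes "unconditional A" shows "unconditional (enlargement A h)"
  unfolding unconditional_def
proof (intro allI impI ballI)
  fix x1 x2 a b :: real assume "(x1, x2) \<in> enlargement A h" and ab: "a \<in> {-1, 1}" "b \<in> {-1, 1}"
  then obtain y1 y2 where y: "(y1, y2) \<in> A" "l1_norm ((x1, x2) - (y1, y2)) < h"
    by (auto simp: enlargement_def)
  have "(a * y1, b * y2) \<in> A" using assms y(1) ab unfolding unconditional_def by blast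
  moreover have "l1_norm ((a * x1, b * x2) - (a * y1, b * y2)) = l1_norm ((x1, x2) - (y1, y2))"
    using ab by (auto simp: l1_norm_def)
  ultimately show "(a * x1, b * x2) \<in> enlargement A h"
    using y(2) unfolding enlargement_def by (intro CollectI bexI[of _ "(a * y1, b * y2)"]) auto
qed

text \<open>The slope \<open>k\<close> depends only on \<open>m\<close> and on the diagonal ray, so the term
\<open>k (\<gamma>(A\<^sub>u) - m)\<close> integrates to \<open>0\<close>.\<close>

lemma enlargement_rate_closed:
  assumes A: "closed A" "unconditional A" and h: "\<And>n. 0 < h n" "h \<longlonglongrightarrow> 0" "decseq h"
    and adm: "\<And>l. 0 \<le> l \<Longrightarrow> l \<le> 1 \<Longrightarrow> \<exists>k. admissible_slope i (measure sym_exp_measure A) l k" and i: "0 \<le> i"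
  shows "ennreal i \<le> liminf (\<lambda>n. (emeasure sym_exp_measure (enlargement A (h n)) - emeasure sym_exp_measure A) / ennreal (h n))"
proof -
  have Ab [measurable]: "A \<in> sets borel" using A by auto
  let ?J = "gamma2 \<Otimes>\<^sub>M unif"
  let ?l = "measure expo (ray_slice A (1/2))"
  let ?R = "\<lambda>n. radial_thickening (h n) A" and ?P = "\<lambda>n. polar_set (enlargement A (h n))"
  let ?S = "\<lambda>n u. emeasure gamma2 ((\<lambda>s. (s, u)) -` (?R n - polar_set A))"
  define m where "m = measure sym_exp_measure A"
  have meas: "?R n \<in> sets (borel \<Otimes>\<^sub>M borel)" "?P n \<in> sets (borel \<Otimes>\<^sub>M borel)" "polar_set A \<in> sets (borel \<Otimes>\<^sub>M borel)" for n
    by (intro radial_thickening_measurable[OF A(1)] polar_set_measurable borel_open open_enlargement Ab)+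
  have J1: "emeasure ?J X \<le> 1" if "X \<in> sets (borel \<Otimes>\<^sub>M borel)" for X
  proof -
    have "emeasure ?J X \<le> emeasure ?J (space ?J)" by (rule emeasure_space)
    also have "space ?J = UNIV \<times> UNIV" by (simp add: space_pair_measure)
    also have "emeasure ?J (UNIV \<times> UNIV) = 1" by (subst unif.emeasure_pair_measure_Times) (auto simp: emeasure_UNIV emeasure_unif_UNIV)
    finally show ?thesis .
  qed
  have "?l \<le> 1" using expo.finite_measure_mono[of "ray_slice A (1/2)" UNIV] measure_UNIV_1 by simp
  then obtain k where k: "admissible_slope i m ?l k" using adm[of ?l] by (auto simp: m_def)
  have gm: "(\<lambda>u. emeasure gamma2 ((\<lambda>s. (s, u)) -` polar_set A)) \<in> borel_measurable unif"
    by (rule gamma2_unif.measurable_emeasure_Pair2) (unfold sets_pairs, rule meas)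
  define q where "q = (\<lambda>u. measure gamma2 ((\<lambda>s. (s, u)) -` polar_set A))"
  have qm [measurable]: "q \<in> borel_measurable unif" unfolding q_def measure_def using gm by measurable
  have q1: "0 \<le> q u" "q u \<le> 1" for u
    using gamma2.finite_measure_mono[of "(\<lambda>s. (s, u)) -` polar_set A" UNIV] measure_UNIV_1
    by (simp_all add: q_def)
  have qint: "integrable unif q"
    by (rule unif.integrable_const_bound[of _ 1]) (use q1 in auto)
  have "(\<integral>\<^sup>+u. ennreal (q u) \<partial>unif) = emeasure ?J (polar_set A)"
    unfolding q_def gamma2.emeasure_eq_measure[symmetric]
    by (rule gamma2_unif.emeasure_pair_measure_alt2[symmetric]) (unfold sets_pairs, rule meas)
  also have "\<dots> = emeasure sym_exp_measure A" using emeasure_sym_polar[OF Ab A(2)] by simp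
  finally have qI: "integral\<^sup>L unif q = m"
    using integral_eq_nn_integral[of q unif] q1 by (simp add: m_def measure_def)
  let ?f = "\<lambda>u. i + k * (q u - m)"
  have fint: "integrable unif ?f" using qint by simp
  have "i = (\<integral>u. ?f u \<partial>unif)"
    using qint qI by (simp add: measure_def emeasure_unif_UNIV)
  (* The lower bound of a slice may be negative; truncation at \<open>0\<close> moves it into \<open>ennreal\<close>. *)
  also have "\<dots> \<le> (\<integral>u. max 0 (?f u) \<partial>unif)"
    by (rule integral_mono) (use fint in auto)
  finally have "ennreal i \<le> ennreal (\<integral>u. max 0 (?f u) \<partial>unif)" by (rule ennreal_leI)
  also have "\<dots> = (\<integral>\<^sup>+u. ennreal (max 0 (?f u)) \<partial>unif)"
    by (rule nn_integral_eq_integral[symmetric]) (use fint in auto)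
  also have "\<dots> = (\<integral>\<^sup>+u. ennreal (?f u) \<partial>unif)"
    by (intro nn_integral_cong) (simp add: max_def ennreal_neg)
  also have "\<dots> \<le> (\<integral>\<^sup>+u. liminf (\<lambda>n. ?S n u / ennreal (h n)) + emeasure expo ((\<lambda>s. (s, u)) -` diagonal_defect A) \<partial>unif)"
  proof (rule nn_integral_mono_AE, use AE_unif in eventually_elim)
    case (elim u)
    have "(\<lambda>s. (s, u)) -` polar_set A = ray_slice A u" using elim by (auto simp: polar_set_def ray_slice_def)
    hence "ennreal (?f u) \<le> liminf (\<lambda>n. emeasure gamma2 (thicken (h n) (ray_slice A u) - ray_slice A u) / ennreal (h n))
       + ennreal \<bar>measure expo (ray_slice A u) - ?l\<bar>"
      using slice_rate[OF closed_ray_slice[OF A(1)] h(1,2) k, of u] \<open>?l \<le> 1\<close>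
      by (auto simp: ray_slice_def q_def)
    also have "\<dots> \<le> liminf (\<lambda>n. ?S n u / ennreal (h n)) + emeasure expo ((\<lambda>s. (s, u)) -` diagonal_defect A)"
      using elim diagonal_defect_slice[OF A(1)] by (intro add_mono) (simp_all add: radial_slice[OF A(1)])
    finally show ?case .
  qed
  also have "\<dots> = (\<integral>\<^sup>+u. liminf (\<lambda>n. ?S n u / ennreal (h n)) \<partial>unif) + (\<integral>\<^sup>+u. emeasure expo ((\<lambda>s. (s, u)) -` diagonal_defect A) \<partial>unif)"
  proof (rule nn_integral_add)
    have [measurable]: "?S n \<in> borel_measurable unif" for n by (rule radial_part(1)[OF A(1)])
    show "(\<lambda>u. liminf (\<lambda>n. ?S n u / ennreal (h n))) \<in> borel_measurable unif" by measurable
    show "(\<lambda>u. emeasure expo ((\<lambda>s. (s, u)) -` diagonal_defect A)) \<in> borel_measurable unif"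
      by (rule expo_unif.measurable_emeasure_Pair2) (unfold sets_pairs, rule diagonal_defect_measurable[OF A(1)])
  qed
  also have "\<dots> \<le> liminf (\<lambda>n. emeasure ?J (?R n - polar_set A) / ennreal (h n)) + liminf (\<lambda>n. emeasure ?J (?P n - ?R n) / ennreal (h n))"
    by (intro add_mono radial_part(2)[OF A(1)] transversal_part[OF A(1) h])
  also have "\<dots> \<le> liminf (\<lambda>n. emeasure ?J (?R n - polar_set A) / ennreal (h n) + emeasure ?J (?P n - ?R n) / ennreal (h n))"
    by (rule liminf_add_ennreal)
  also have "(\<lambda>n. emeasure ?J (?R n - polar_set A) / ennreal (h n) + emeasure ?J (?P n - ?R n) / ennreal (h n))
    = (\<lambda>n. (emeasure sym_exp_measure (enlargement A (h n)) - emeasure sym_exp_measure A) / ennreal (h n))"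
  proof
    fix n
    have "emeasure ?J (?R n - polar_set A) + emeasure ?J (?P n - ?R n) = emeasure ?J ((?R n - polar_set A) \<union> (?P n - ?R n))"
      by (rule plus_emeasure) (use meas in auto)
    also have "(?R n - polar_set A) \<union> (?P n - ?R n) = ?P n - polar_set A"
      using polar_subset_radial[OF h(1)[of n], of A] radial_subset_enlargement[of "h n" A] by blast
    also have "emeasure ?J (?P n - polar_set A) = emeasure ?J (?P n) - emeasure ?J (polar_set A)"
      using polar_subset_radial[OF h(1)[of n], of A] radial_subset_enlargement[of "h n" A] meas J1[OF meas(3)]
      by (intro emeasure_Diff) (auto simp: top_unique)
    also have "\<dots> = emeasure sym_exp_measure (enlargement A (h n)) - emeasure sym_exp_measure A"
      using A by (simp add: emeasure_sym_polar unconditional_enlargement open_enlargement borel_open)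
    finally show "emeasure ?J (?R n - polar_set A) / ennreal (h n) + emeasure ?J (?P n - ?R n) / ennreal (h n)
      = (emeasure sym_exp_measure (enlargement A (h n)) - emeasure sym_exp_measure A) / ennreal (h n)"
      by (simp flip: add_divide_distrib_ennreal)
  qed
  finally show ?thesis .
qed

section \<open>Balls and their complements\<close>

lemma emeasure_gamma2_unif_Times:
  "X \<in> sets borel \<Longrightarrow> Y \<in> sets borel \<Longrightarrow> emeasure (gamma2 \<Otimes>\<^sub>M unif) (X \<times> Y) = emeasure gamma2 X * emeasure unif Y"
  by (rule unif.emeasure_pair_measure_Times) auto

lemma emeasure_sym_outside:
  assumes "0 \<le> r"
  shows "emeasure sym_exp_measure {x. r < l1_norm x} = ennreal (- gamma2_prim r)"
    and "emeasure sym_exp_measure UNIV = 1"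
proof -
  have "open {x. r < l1_norm x}" unfolding l1_norm_def by (intro open_Collect_less continuous_intros)
  moreover have "unconditional {x. r < l1_norm x}" by (auto simp: unconditional_def l1_norm_def)
  ultimately have "emeasure sym_exp_measure {x. r < l1_norm x} = emeasure (gamma2 \<Otimes>\<^sub>M unif) (polar_set {x. r < l1_norm x})"
    by (intro emeasure_sym_polar) auto
  also have "polar_set {x. r < l1_norm x} = {r<..} \<times> {0<..<1}"
    using assms by (auto simp: polar_set_def l1_norm_ray_point)
  also have "emeasure (gamma2 \<Otimes>\<^sub>M unif) ({r<..} \<times> {0<..<1}) = emeasure gamma2 {r<..} * emeasure unif {0<..<1}"
    by (rule emeasure_gamma2_unif_Times) auto
  also have "\<dots> = ennreal (- gamma2_prim r)" using assms by (simp add: emeasure_Ioi emeasure_unif)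
  finally show "emeasure sym_exp_measure {x. r < l1_norm x} = ennreal (- gamma2_prim r)" .
  have "emeasure sym_exp_measure UNIV = emeasure (gamma2 \<Otimes>\<^sub>M unif) (polar_set UNIV)"
    by (intro emeasure_sym_polar) (auto simp: unconditional_def)
  also have "polar_set UNIV = {0..} \<times> {0<..<1}" by (auto simp: polar_set_def)
  also have "emeasure (gamma2 \<Otimes>\<^sub>M unif) ({0..} \<times> {0<..<1}) = emeasure gamma2 {0..} * emeasure unif {0<..<1}"
    by (rule emeasure_gamma2_unif_Times) auto
  also have "\<dots> = 1" by (simp add: emeasure_Ici emeasure_unif gamma2_prim_def)
  finally show "emeasure sym_exp_measure UNIV = 1" .
qed

interpretation sym: finite_measure sym_exp_measure
  by (rule finite_measureI) (simp add: emeasure_sym_outside(2)[OF order_refl])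

lemma measure_sym_UNIV: "measure sym_exp_measure UNIV = 1"
  by (simp add: measure_def emeasure_sym_outside(2)[OF order_refl])

lemma measure_sym_outside: "0 \<le> r \<Longrightarrow> measure sym_exp_measure {x. r < l1_norm x} = - gamma2_prim r"
  by (simp add: measure_def emeasure_sym_outside gamma2_prim_def mult_nonpos_nonneg)

lemma l1_borel: "{x. r < l1_norm x} \<in> sets borel" "{x. l1_norm x \<le> r} \<in> sets borel"
  unfolding l1_norm_def
  by (intro borel_open open_Collect_less borel_closed closed_Collect_le continuous_intros)+

lemma measure_sym_inside: "0 \<le> r \<Longrightarrow> measure sym_exp_measure {x. l1_norm x \<le> r} = 1 + gamma2_prim r"
proof -
  assume r: "0 \<le> r"
  have "{x. l1_norm x \<le> r} = UNIV - {x. r < l1_norm x}" by auto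
  thus ?thesis using sym.finite_measure_compl[of "{x. r < l1_norm x}"] l1_borel r
    by (simp add: measure_sym_outside measure_sym_UNIV)
qed

lemma l1_ball_finite:
  assumes "t \<noteq> 0" "t \<noteq> \<infinity>"
  shows "0 < enn2real t" "l1_ball t = {x. l1_norm x \<le> enn2real t}"
proof -
  show t: "0 < enn2real t" using assms by (simp add: enn2real_positive_iff less_top[symmetric] zero_less_iff_neq_zero)
  have sc: "l1_norm (c *\<^sub>R x) = c * l1_norm x" if "0 \<le> c" for c x
    using that by (simp add: l1_norm_def abs_mult distrib_left)
  have "x \<in> (\<lambda>x. enn2real t *\<^sub>R x) ` l1_unit_ball" if "l1_norm x \<le> enn2real t" for x
    using that t by (intro image_eqI[of _ _ "inverse (enn2real t) *\<^sub>R x"]) (simp_all add: l1_unit_ball_def sc field_simps)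
  moreover have "l1_norm (enn2real t *\<^sub>R x) \<le> enn2real t" if "x \<in> l1_unit_ball" for x
    using that t by (simp add: l1_unit_ball_def sc)
  ultimately show "l1_ball t = {x. l1_norm x \<le> enn2real t}"
    using assms by (auto simp only: l1_ball_def if_False)
qed

lemma l1_norm_triangle: "l1_norm x \<le> l1_norm (x - y) + l1_norm y" "l1_norm y \<le> l1_norm (x - y) + l1_norm x"
  by (auto simp: l1_norm_def)

lemma gamma2_prim_quotient:
  "((\<lambda>h. (gamma2_prim (r + h) - gamma2_prim r) / h) \<longlongrightarrow> ent (exp (- r))) (at_right 0)"
  "((\<lambda>h. (gamma2_prim r - gamma2_prim (r - h)) / h) \<longlongrightarrow> ent (exp (- r))) (at_right 0)"
proof -
  have 1: "((\<lambda>h. (gamma2_prim (r + h) - gamma2_prim r) / h) \<longlongrightarrow> ent (exp (- r))) (at 0)"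
    using gamma2_prim_deriv[of r] by (simp add: DERIV_def ent_def mult.commute)
  thus "((\<lambda>h. (gamma2_prim (r + h) - gamma2_prim r) / h) \<longlongrightarrow> ent (exp (- r))) (at_right 0)"
    by (rule tendsto_mono[OF at_le, rotated]) simp
  have "filterlim (\<lambda>h::real. - h) (at 0) (at_right 0)"
    unfolding filterlim_at by (auto intro!: tendsto_eq_intros simp: eventually_at_filter)
  from filterlim_compose[OF 1 this]
  show "((\<lambda>h. (gamma2_prim r - gamma2_prim (r - h)) / h) \<longlongrightarrow> ent (exp (- r))) (at_right 0)"
    by (simp add: minus_divide_left)
qed

text \<open>For upper bounds on balls and their complements it is enough to dominate the difference
quotients by a convergent function.\<close>

lemma boundary_measure_le:
  assumes "\<forall>\<^sub>F h in at_right 0. (measure sym_exp_measure (enlargement A h) - measure sym_exp_measure A) / h \<le> g h"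
    and "(g \<longlongrightarrow> i) (at_right 0)"
  shows "boundary_measure sym_exp_measure A \<le> ereal i"
proof -
  have "boundary_measure sym_exp_measure A \<le> Liminf (at_right 0) (\<lambda>h. ereal (g h))"
    unfolding boundary_measure_def by (rule Liminf_mono) (use assms(1) in simp)
  also have "\<dots> = ereal i"
    by (rule lim_imp_Liminf) (use assms(2) in auto)
  finally show ?thesis .
qed

lemma boundary_ball_le:
  assumes r: "0 \<le> r"
  shows "boundary_measure sym_exp_measure {x. l1_norm x \<le> r} \<le> ereal (ent (exp (- r)))"
proof (rule boundary_measure_le[OF _ gamma2_prim_quotient(1)])
  show "\<forall>\<^sub>F h in at_right 0. (measure sym_exp_measure (enlargement {x. l1_norm x \<le> r} h)
      - measure sym_exp_measure {x. l1_norm x \<le> r}) / h \<le> (gamma2_prim (r + h) - gamma2_prim r) / h"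
    using eventually_at_right_less[of 0]
  proof eventually_elim
    case (elim h)
    have "enlargement {x. l1_norm x \<le> r} h \<subseteq> {x. l1_norm x \<le> r + h}"
    proof
      fix x assume "x \<in> enlargement {x. l1_norm x \<le> r} h"
      then obtain y where "l1_norm y \<le> r" "l1_norm (x - y) < h" by (auto simp: enlargement_def)
      thus "x \<in> {x. l1_norm x \<le> r + h}" using l1_norm_triangle(1)[of x y] by simp
    qed
    hence "measure sym_exp_measure (enlargement {x. l1_norm x \<le> r} h) \<le> measure sym_exp_measure {x. l1_norm x \<le> r + h}"
      by (rule sym.finite_measure_mono) (simp add: l1_borel)
    thus ?case using elim r by (intro divide_right_mono) (simp_all add: measure_sym_inside)
  qed
qed

lemma boundary_compl_ball_le:
  assumes r: "0 < r"
  shows "boundary_measure sym_exp_measure {x. r < l1_norm x} \<le> ereal (ent (exp (- r)))"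
proof (rule boundary_measure_le[OF _ gamma2_prim_quotient(2)])
  have "\<forall>\<^sub>F h in at_right 0. 0 < h \<and> h < r"
    using eventually_at_right_real[OF r] by (auto elim: eventually_mono)
  thus "\<forall>\<^sub>F h in at_right 0. (measure sym_exp_measure (enlargement {x. r < l1_norm x} h)
      - measure sym_exp_measure {x. r < l1_norm x}) / h \<le> (gamma2_prim r - gamma2_prim (r - h)) / h"
  proof eventually_elim
    case (elim h)
    have "enlargement {x. r < l1_norm x} h \<subseteq> {x. r - h < l1_norm x}"
    proof
      fix x assume "x \<in> enlargement {x. r < l1_norm x} h"
      then obtain y where "r < l1_norm y" "l1_norm (x - y) < h" by (auto simp: enlargement_def)
      thus "x \<in> {x. r - h < l1_norm x}" using l1_norm_triangle(2)[of y x] by simp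
    qed
    hence "measure sym_exp_measure (enlargement {x. r < l1_norm x} h) \<le> measure sym_exp_measure {x. r - h < l1_norm x}"
      by (rule sym.finite_measure_mono) (simp add: l1_borel)
    thus ?case using elim r by (intro divide_right_mono) (simp_all add: measure_sym_outside)
  qed
qed

section \<open>Borel sets\<close>

lemma enlargement_closure: "enlargement (closure A) h = enlargement A h"
proof (intro equalityI subsetI)
  fix x assume "x \<in> enlargement (closure A) h"
  then obtain y where y: "y \<in> closure A" "l1_norm (x - y) < h" by (auto simp: enlargement_def)
  have "open {y. l1_norm (x - y) < h}"
    unfolding l1_norm_def by (intro open_Collect_less continuous_intros)
  hence "A \<inter> {y. l1_norm (x - y) < h} \<noteq> {}"
    using y open_Int_closure_eq_empty[of "{y. l1_norm (x - y) < h}" A] by blast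
  thus "x \<in> enlargement A h" by (auto simp: enlargement_def)
next
  fix x assume "x \<in> enlargement A h"
  thus "x \<in> enlargement (closure A) h" using closure_subset by (fastforce simp: enlargement_def)
qed

lemma unconditional_closure:
  assumes "unconditional A" shows "unconditional (closure A)"
  unfolding unconditional_def
proof (intro allI impI ballI)
  fix x1 x2 a b :: real assume x: "(x1, x2) \<in> closure A" and ab: "a \<in> {-1, 1}" "b \<in> {-1, 1}"
  let ?f = "\<lambda>p. (a * fst p, b * snd p)"
  have "?f ` closure A \<subseteq> closure A"
  proof (rule image_closure_subset)
    show "continuous_on (closure A) ?f" by (intro continuous_intros)
    show "?f ` A \<subseteq> closure A"
      using assms ab closure_subset unfolding unconditional_def by fastforce
  qed simp
  thus "(a * x1, b * x2) \<in> closure A" using x by force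
qed

lemma subset_enlargement: "0 < h \<Longrightarrow> A \<subseteq> enlargement A h"
  by (force simp: enlargement_def l1_norm_def)

text \<open>The lower bound in the form used for both kinds of competitors; \<open>i\<close> is any number for
which every \<open>l\<close> has a supporting slope.\<close>

lemma boundary_measure_ge:
  assumes A: "A \<in> sets borel" "unconditional A" and i: "0 \<le> i"
    and adm: "\<And>l. 0 \<le> l \<Longrightarrow> l \<le> 1 \<Longrightarrow> \<exists>k. admissible_slope i (measure sym_exp_measure A) l k"
  shows "ereal i \<le> boundary_measure sym_exp_measure A"
  unfolding boundary_measure_def le_Liminf_iff
proof (intro allI impI)
  fix y :: ereal assume y: "y < ereal i"
  let ?m = "measure sym_exp_measure"
  let ?q = "\<lambda>h. (?m (enlargement A h) - ?m A) / h"
  have q0: "0 \<le> ?q h" if "0 < h" for h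
    using that sym.finite_measure_mono[OF subset_enlargement[OF that, of A]] open_enlargement[of A h] by simp
  have cA: "?m A \<le> ?m (closure A)"
    by (rule sym.finite_measure_mono[OF closure_subset]) simp
  show "\<forall>\<^sub>F h in at_right 0. y < ereal (?q h)"
  proof (cases "?m (closure A) = ?m A")
    case False
    define d where "d = ?m (closure A) - ?m A"
    have d: "0 < d" using False cA by (simp add: d_def)
    (* The enlargements have measure at least \<open>\<mu>(A) + d\<close>, so the quotient is at least \<open>d / h\<close>. *)
    have "0 < d / (i + 1)" using d i by simp
    hence "\<forall>\<^sub>F h in at_right 0. 0 < h \<and> h < d / (i + 1)"
      using eventually_at_right_real by (auto elim: eventually_mono)
    thus ?thesis
    proof eventually_elim
      case (elim h)
      have "?m (closure A) \<le> ?m (enlargement A h)"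
        using sym.finite_measure_mono[OF subset_enlargement[of h "closure A"]] elim open_enlargement[of A h]
        by (simp add: enlargement_closure)
      hence "d / h \<le> ?q h" using elim by (intro divide_right_mono) (auto simp: d_def)
      moreover have "i < d / h"
      proof -
        have "(i + 1) * h < d" using elim i by (simp add: field_simps)
        moreover have "i * h < (i + 1) * h" using elim by simp
        ultimately have "i * h < d" by linarith
        thus ?thesis using elim by (simp add: field_simps)
      qed
      ultimately have "ereal i < ereal (?q h)" by simp
      with y show ?case by (rule less_trans)
    qed
  next
    case True
    show ?thesis
    proof (rule sequentially_imp_eventually_at_right[of 0 1])
      fix h :: "nat \<Rightarrow> real" assume h: "\<And>n. 0 < h n" "decseq h" "h \<longlonglongrightarrow> 0"
      have "ennreal i \<le> liminf (\<lambda>n. (emeasure sym_exp_measure (enlargement (closure A) (h n)) - emeasure sym_exp_measure (closure A)) / ennreal (h n))"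
        by (rule enlargement_rate_closed) (use A h i adm True in \<open>auto intro: unconditional_closure\<close>)
      also have "(\<lambda>n. (emeasure sym_exp_measure (enlargement (closure A) (h n)) - emeasure sym_exp_measure (closure A)) / ennreal (h n))
        = (\<lambda>n. ennreal (?q (h n)))"
      proof
        fix n
        have "?m A \<le> ?m (enlargement A (h n))"
          using sym.finite_measure_mono[OF subset_enlargement[OF h(1), of A]] open_enlargement[of A "h n"] by simp
        thus "(emeasure sym_exp_measure (enlargement (closure A) (h n)) - emeasure sym_exp_measure (closure A)) / ennreal (h n) = ennreal (?q (h n))"
          using h(1)[of n] True by (simp add: enlargement_closure sym.emeasure_eq_measure ennreal_minus divide_ennreal)
      qed
      finally have lim: "ennreal i \<le> liminf (\<lambda>n. ennreal (?q (h n)))" .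
      show "\<forall>\<^sub>F n in sequentially. y < ereal (?q (h n))"
      proof (cases "0 \<le> y")
        case False
        hence "y < ereal 0" by (simp add: zero_ereal_def[symmetric])
        moreover have "ereal 0 \<le> ereal (?q (h n))" for n using q0[OF h(1)[of n]] by simp
        ultimately show ?thesis by (intro always_eventually allI) (rule less_le_trans)
      next
        case True
        then obtain r where r: "y = ereal r" "0 \<le> r" "r < i" using y by (cases y) auto
        have "ennreal r < liminf (\<lambda>n. ennreal (?q (h n)))"
          using r i lim by (intro less_le_trans[OF _ lim]) (simp add: ennreal_lessI)
        hence "\<forall>\<^sub>F n in sequentially. ennreal r < ennreal (?q (h n))" by (rule less_LiminfD)
        thus ?thesis by eventually_elim (use r q0 h in \<open>auto simp: ennreal_less_iff\<close>)
      qed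
    qed simp
  qed
qed

theorem corollary3:
  fixes A :: "(real \<times> real) set" and t s :: ennreal
  assumes "A \<in> sets borel"
    and "unconditional A"
    and "measure sym_exp_measure (l1_ball t) = measure sym_exp_measure A"
    and "measure sym_exp_measure A = measure sym_exp_measure (UNIV - l1_ball s)"
  shows "boundary_measure sym_exp_measure A \<ge>
           min (boundary_measure sym_exp_measure (l1_ball t))
               (boundary_measure sym_exp_measure (UNIV - l1_ball s))"
proof -
  define m where "m = measure sym_exp_measure A"
  have empty: "boundary_measure sym_exp_measure {} \<le> ereal 0"
    by (rule boundary_measure_le[of _ "\<lambda>_. 0"]) (auto simp: enlargement_def)
  have univ: "boundary_measure sym_exp_measure UNIV \<le> ereal 0"
  proof (rule boundary_measure_le[of _ "\<lambda>_. 0"])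
    show "\<forall>\<^sub>F h in at_right 0. (measure sym_exp_measure (enlargement UNIV h) - measure sym_exp_measure UNIV) / h \<le> 0"
      using eventually_at_right_less[of 0]
      by eventually_elim
        (auto simp: divide_le_0_iff intro!: sym.finite_measure_mono)
  qed simp
  show ?thesis
  proof (cases "m \<le> 1/2")
    case True
    obtain x where x: "0 \<le> x" "x \<le> 1" "x + ent x = m"
      "boundary_measure sym_exp_measure (UNIV - l1_ball s) \<le> ereal (ent x)"
    proof (cases "s = 0 \<or> s = \<infinity>")
      case True
      hence "s \<noteq> 0" using \<open>m \<le> 1/2\<close> assms(4) measure_sym_UNIV by (auto simp: m_def l1_ball_def)
      with True have E: "UNIV - l1_ball s = {}" by (simp add: l1_ball_def)
      have "m = 0" using assms(4) unfolding E m_def by simp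
      moreover have "boundary_measure sym_exp_measure (UNIV - l1_ball s) \<le> ereal 0"
        unfolding E by (rule empty)
      ultimately show ?thesis by (intro that[of 0]) auto
    next
      case False
      define r where "r = enn2real s"
      have r: "0 < r" "UNIV - l1_ball s = {x. r < l1_norm x}"
        using l1_ball_finite[of s] False by (auto simp: r_def)
      have "exp (- r) + ent (exp (- r)) = m"
        using assms(4) measure_sym_outside[of r] r by (simp add: m_def gamma2_prim_def ent_def algebra_simps)
      thus ?thesis using r boundary_compl_ball_le[OF r(1)] by (intro that[of "exp (- r)"]) auto
    qed
    have "ereal (ent x) \<le> boundary_measure sym_exp_measure A"
      by (rule boundary_measure_ge[OF assms(1,2)])
        (use x True admissible_exists[of x m] ent_nonneg[of x] in \<open>auto simp: m_def\<close>)
    from order_trans[OF x(4) this] show ?thesis by (simp add: min_le_iff_disj)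
  next
    case False
    obtain x where x: "0 \<le> x" "x \<le> 1" "x + ent x = 1 - m"
      "boundary_measure sym_exp_measure (l1_ball t) \<le> ereal (ent x)"
    proof (cases "t = 0 \<or> t = \<infinity>")
      case True
      hence "t \<noteq> 0" using False assms(3) by (auto simp: m_def l1_ball_def)
      with True have "l1_ball t = UNIV" by (simp add: l1_ball_def)
      thus ?thesis using assms(3) univ measure_sym_UNIV by (intro that[of 0]) (auto simp: m_def)
    next
      case nt: False
      define r where "r = enn2real t"
      have r: "0 < r" "l1_ball t = {x. l1_norm x \<le> r}"
        using l1_ball_finite[of t] nt by (auto simp: r_def)
      have "exp (- r) + ent (exp (- r)) = 1 - m"
        using assms(3) measure_sym_inside[of r] r by (simp add: m_def gamma2_prim_def ent_def algebra_simps)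
      thus ?thesis using r boundary_ball_le[of r] by (intro that[of "exp (- r)"]) auto
    qed
    have adm: "\<exists>k. admissible_slope (ent x) m l k" if l: "0 \<le> l" "l \<le> 1" for l
    proof -
      obtain k where "admissible_slope (ent x) (1 - m) (1 - l) k"
        using admissible_exists[of x "1 - m" "1 - l"] x False l by auto
      thus ?thesis using admissible_flip[of "ent x" "1 - m" "1 - l" k] by auto
    qed
    have "ereal (ent x) \<le> boundary_measure sym_exp_measure A"
      by (rule boundary_measure_ge[OF assms(1,2)])
        (use x adm ent_nonneg[of x] in \<open>auto simp: m_def\<close>)
    from order_trans[OF x(4) this] show ?thesis by (simp add: min_le_iff_disj)
  qed
qed

end
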